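(* Let $T$ be a tree with diameter $\ge 4$. Suppose that every vertex of degree $2$ in $T$ has no leaf neighbours. Let $w_0,\ldots,w_t$ be a longest path in $T$ such that the internal vertices $w_1,\ldots,w_{t-1}$ each have degree $2$ in $T$. Let $r:= \max\{t,2\}$. Then $$\mathrm{sat}^\ast(n,T)\ge \left(1+\frac{1}{12r+52}\right)n+O(1). $$
   Context: All graphs are finite and simple. An edge-colouring of a graph is proper if any two distinct edges sharing a vertex receive different colours. A rainbow copy of $H$ in an edge-coloured graph $G$ is a subgraph of $G$ isomorphic to $H$ all of whose edges have distinct colours. A graph $G$ is properly rainbow $H$-saturated if (1) there is a proper edge-colouring of $G$ containing no rainbow copy of $H$, and (2) for every non-edge $e \notin E(G)$ (a pair of distinct non-adjacent vertices of $G$), every proper edge-colouring of $G+e$ contains a rainbow copy of $H$. The proper rainbow saturation number $\mathrm{sat}^\ast(n,H)$ is the minimum number of edges in a properly rainbow $H$-saturated graph on $n$ vertices. The diameter of a graph is the maximum distance (number of edges in a shortest path) between two of its vertices. The $O(1)$ term is as $n\to\infty$ with $T$ fixed, i.e. it is bounded in absolute value by a constant depending only on $T$. *)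

theory Defs
  imports Complex_Main "HOL-Library.Landau_Symbols"
begin

record 'a graph =
  vertices :: "'a set"
  edges :: "'a set set"

definition finite_simple_graph :: "'a graph \<Rightarrow> bool" where
  "finite_simple_graph G \<longleftrightarrow>
     finite (vertices G) \<and> (\<forall>e\<in>edges G. e \<subseteq> vertices G \<and> card e = 2)"

definition add_edge :: "'a graph \<Rightarrow> 'a set \<Rightarrow> 'a graph" where
  "add_edge G e = G\<lparr>edges := insert e (edges G)\<rparr>"

definition vertex_degree :: "'a graph \<Rightarrow> 'a \<Rightarrow> nat" where
  "vertex_degree G v = card {e \<in> edges G. v \<in> e}"

definition leaf :: "'a graph \<Rightarrow> 'a \<Rightarrow> bool" where
  "leaf G v \<longleftrightarrow> v \<in> vertices G \<and> vertex_degree G v = 1"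

text \<open>Walks and paths are given by their nonempty lists of vertices, so a list of length
  \<open>k + 1\<close> has \<open>k\<close> edges.\<close>

definition graph_walk :: "'a graph \<Rightarrow> 'a list \<Rightarrow> bool" where
  "graph_walk G p \<longleftrightarrow> p \<noteq> [] \<and> set p \<subseteq> vertices G \<and>
     (\<forall>i. Suc i < length p \<longrightarrow> {p ! i, p ! Suc i} \<in> edges G)"

definition graph_path :: "'a graph \<Rightarrow> 'a list \<Rightarrow> bool" where
  "graph_path G p \<longleftrightarrow> graph_walk G p \<and> distinct p"

definition connected_graph :: "'a graph \<Rightarrow> bool" where
  "connected_graph G \<longleftrightarrow> vertices G \<noteq> {} \<and>
     (\<forall>u\<in>vertices G. \<forall>v\<in>vertices G. \<exists>p. graph_walk G p \<and> hd p = u \<and> last p = v)"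

definition graph_cycle :: "'a graph \<Rightarrow> 'a list \<Rightarrow> bool" where
  "graph_cycle G p \<longleftrightarrow> graph_path G p \<and> length p \<ge> 3 \<and> {last p, hd p} \<in> edges G"

definition is_tree :: "'a graph \<Rightarrow> bool" where
  "is_tree G \<longleftrightarrow> finite_simple_graph G \<and> connected_graph G \<and> (\<nexists>p. graph_cycle G p)"

text \<open>The distance and the diameter are only meaningful in a finite connected graph: otherwise
  the infimum or the maximum may be taken over an empty or infinite set.\<close>

definition graph_distance :: "'a graph \<Rightarrow> 'a \<Rightarrow> 'a \<Rightarrow> nat" where
  "graph_distance G u v = Inf {length p - 1 | p. graph_path G p \<and> hd p = u \<and> last p = v}"

definition graph_diameter :: "'a graph \<Rightarrow> nat" where
  "graph_diameter G = Max {graph_distance G u v | u v. u \<in> vertices G \<and> v \<in> vertices G}"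

definition subgraph :: "'a graph \<Rightarrow> 'a graph \<Rightarrow> bool" where
  "subgraph K G \<longleftrightarrow> finite_simple_graph K \<and> vertices K \<subseteq> vertices G \<and> edges K \<subseteq> edges G"

definition isomorphic :: "'a graph \<Rightarrow> 'b graph \<Rightarrow> bool" where
  "isomorphic G H \<longleftrightarrow> (\<exists>f. bij_betw f (vertices G) (vertices H) \<and>
     (\<forall>u\<in>vertices G. \<forall>v\<in>vertices G. {u, v} \<in> edges G \<longleftrightarrow> {f u, f v} \<in> edges H))"

text \<open>Colours are natural numbers; as all graphs are finite, this is no restriction on the
  set of colours. The values of a colouring outside the edge set are irrelevant.\<close>

definition proper_colouring :: "'a graph \<Rightarrow> ('a set \<Rightarrow> nat) \<Rightarrow> bool" where
  "proper_colouring G c \<longleftrightarrow>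
     (\<forall>e\<in>edges G. \<forall>f\<in>edges G. e \<noteq> f \<and> e \<inter> f \<noteq> {} \<longrightarrow> c e \<noteq> c f)"

definition has_rainbow_copy :: "'a graph \<Rightarrow> ('a set \<Rightarrow> nat) \<Rightarrow> 'b graph \<Rightarrow> bool" where
  "has_rainbow_copy G c H \<longleftrightarrow>
     (\<exists>K. subgraph K G \<and> isomorphic K H \<and> inj_on c (edges K))"

definition properly_rainbow_saturated :: "'a graph \<Rightarrow> 'b graph \<Rightarrow> bool" where
  "properly_rainbow_saturated G H \<longleftrightarrow>
     (\<exists>c. proper_colouring G c \<and> \<not> has_rainbow_copy G c H) \<and>
     (\<forall>u\<in>vertices G. \<forall>v\<in>vertices G. u \<noteq> v \<and> {u, v} \<notin> edges G \<longrightarrow>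
        (\<forall>c. proper_colouring (add_edge G {u, v}) c \<longrightarrow>
             has_rainbow_copy (add_edge G {u, v}) c H))"

text \<open>Every finite graph has an isomorphic copy with vertices in \<^typ>\<open>nat\<close>. The set below is
  nonempty, so that the infimum is a minimum, whenever \<open>H\<close> has an edge: take a graph with
  the most edges among those on \<open>n\<close> vertices that satisfy the first condition.\<close>

definition sat_star :: "nat \<Rightarrow> 'b graph \<Rightarrow> nat" where
  "sat_star n H = Inf {card (edges G) | G :: nat graph.
     finite_simple_graph G \<and> card (vertices G) = n \<and> properly_rainbow_saturated G H}"

text \<open>A path \<open>w\<^sub>0, \<dots>, w\<^sub>t\<close> whose internal vertices \<open>w\<^sub>1, \<dots>, w\<^sub>t\<^sub>-\<^sub>1\<close> all have degree 2.\<close>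

definition bare_path :: "'a graph \<Rightarrow> 'a list \<Rightarrow> bool" where
  "bare_path G w \<longleftrightarrow> graph_path G w \<and>
     (\<forall>i. 1 \<le> i \<and> Suc i < length w \<longrightarrow> vertex_degree G (w ! i) = 2)"

definition longest_bare_path :: "'a graph \<Rightarrow> 'a list \<Rightarrow> bool" where
  "longest_bare_path G w \<longleftrightarrow> bare_path G w \<and>
     (\<forall>w'. bare_path G w' \<longrightarrow> length w' \<le> length w)"

end

(* Let G be properly rainbow T-saturated, with a rainbow-T-free colouring c. In T the neighbour of a
   leaf has degree at least 3, and the two ends of a longest path yield two non-adjacent vertices of
   degree at least 3; these are the only properties of T that matter.

   Recolouring pendant edges shows that no two leaves of G share a neighbour and that all but two
   leaves have a neighbour of degree at least 3. So, after deleting the leaves, almost all degrees are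
   at least 2, and it remains to see that boundedly many vertices are far from every vertex whose
   remaining degree differs from 2. Around such a vertex x the graph is a long path or a short
   cycle, possibly with pendant edges. It can be recoloured, without creating a rainbow copy, such
   that all pendant edges get one colour C and the colours A, B alternate next to x. If this is
   done at two distant vertices x and y, then a rainbow copy of T in G + xy is confined to the two
   recoloured parts; there a vertex of degree at least 3 is x, y or uses the colour C, which rules
   out two non-adjacent ones. *)
theory Submission
  imports Defs
begin

section \<open>Trees\<close>

text \<open>Condition (2) of saturation speaks of every proper colouring of G+e. Each modified
  colouring is thus a further constraint on G; the obstacle is to modify it without creating a
  rainbow copy that enters the modified part from outside. On a path this needs a buffer between the
  new colours and the untouched edges, in which an old colour is repeated. The buffer makes 4 the
  depth at which a vertex counts as far.

  Depth 4 also fixes the constant. Let W be the set of non-leaves and S the total excess of degrees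
  over 2 after removal of the leaves. The first layer around the vertices of degree other than 2 has
  about 3S vertices at most, and later layers do not grow, so |W| \<le> (1 + 4 * 3) S = 13 S up to
  constants. The excess makes |E| - |V| at least about S/2, and the leaves at most double W, whence
  |E| - |V| is at least |V| / (2 * 13 * 2) = |V| / 52 up to a constant.\<close>

definition nb :: "'a set set \<Rightarrow> 'a \<Rightarrow> 'a set" where
  "nb F v = {w. {v, w} \<in> F}"

text \<open>The isomorphism-invariant part of T that later arguments rest on. Connectedness is
  phrased through closed sets because copies are confined by exhibiting a closed set. The clause
  against triangles serves to separate the neighbours of two leaves joined by a new edge.\<close>

definition branching_tree :: "'a set \<Rightarrow> 'a set set \<Rightarrow> bool" where
  "branching_tree U F \<longleftrightarrow> finite U \<and> (\<forall>e\<in>F. e \<subseteq> U \<and> card e = 2) \<and>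
     (\<forall>I. I \<inter> U \<noteq> {} \<longrightarrow> (\<forall>u v. u \<in> I \<longrightarrow> {u, v} \<in> F \<longrightarrow> v \<in> I) \<longrightarrow> U \<subseteq> I) \<and>
     (\<forall>u v. {u, v} \<in> F \<longrightarrow> card (nb F u) = 1 \<longrightarrow> 3 \<le> card (nb F v)) \<and>
     (\<forall>u v w. {u, v} \<in> F \<longrightarrow> {v, w} \<in> F \<longrightarrow> {u, w} \<notin> F) \<and>
     (\<exists>a\<in>U. \<exists>b\<in>U. a \<noteq> b \<and> {a, b} \<notin> F \<and> 3 \<le> card (nb F a) \<and> 3 \<le> card (nb F b))"

lemma branching_treeI:
  assumes "finite U" "\<And>e. e \<in> F \<Longrightarrow> e \<subseteq> U \<and> card e = 2"
    and "\<And>I. I \<inter> U \<noteq> {} \<Longrightarrow> (\<And>u v. u \<in> I \<Longrightarrow> {u, v} \<in> F \<Longrightarrow> v \<in> I) \<Longrightarrow> U \<subseteq> I"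
    and "\<And>u v. {u, v} \<in> F \<Longrightarrow> card (nb F u) = 1 \<Longrightarrow> 3 \<le> card (nb F v)"
    and "\<And>u v w. {u, v} \<in> F \<Longrightarrow> {v, w} \<in> F \<Longrightarrow> {u, w} \<notin> F"
    and "a \<in> U" "b \<in> U" "a \<noteq> b" "{a, b} \<notin> F" "3 \<le> card (nb F a)" "3 \<le> card (nb F b)"
  shows "branching_tree U F"
  unfolding branching_tree_def
proof (intro conjI allI impI ballI)
  show "U \<subseteq> I" if "I \<inter> U \<noteq> {}" "\<forall>u v. u \<in> I \<longrightarrow> {u, v} \<in> F \<longrightarrow> v \<in> I" for I
    using assms(3)[OF that(1)] that(2) by metis
  show "\<exists>a\<in>U. \<exists>b\<in>U. a \<noteq> b \<and> {a, b} \<notin> F \<and> 3 \<le> card (nb F a) \<and> 3 \<le> card (nb F b)"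
    using assms(6-) by metis
qed (simp_all add: assms)

lemma branching_treeD:
  assumes "branching_tree U F"
  shows "finite U" "e \<in> F \<Longrightarrow> e \<subseteq> U" "e \<in> F \<Longrightarrow> card e = 2"
    and "I \<inter> U \<noteq> {} \<Longrightarrow> (\<And>u v. u \<in> I \<Longrightarrow> {u, v} \<in> F \<Longrightarrow> v \<in> I) \<Longrightarrow> U \<subseteq> I"
    and "{u, v} \<in> F \<Longrightarrow> card (nb F u) = 1 \<Longrightarrow> 3 \<le> card (nb F v)"
    and "{u, v} \<in> F \<Longrightarrow> {v, w} \<in> F \<Longrightarrow> {u, w} \<notin> F"
  using assms unfolding branching_tree_def by (simp_all only:) (metis)+

lemma branching_tree_branches:
  assumes "branching_tree U F"
  obtains a b where "a \<in> U" "b \<in> U" "a \<noteq> b" "{a, b} \<notin> F" "3 \<le> card (nb F a)" "3 \<le> card (nb F b)"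
  using assms unfolding branching_tree_def by (elim conjE bexE) rule

lemma nb_iff [simp]: "w \<in> nb F v \<longleftrightarrow> {v, w} \<in> F"
  by (simp add: nb_def)

lemma vertex_degree_nb:
  assumes "\<forall>e\<in>edges G. card e = 2"
  shows "vertex_degree G v = card (nb (edges G) v)"
proof -
  have "bij_betw (\<lambda>w. {v, w}) (nb (edges G) v) {e \<in> edges G. v \<in> e}"
    unfolding bij_betw_def
  proof
    show "inj_on (\<lambda>w. {v, w}) (nb (edges G) v)"
      by (auto simp: inj_on_def doubleton_eq_iff)
    show "(\<lambda>w. {v, w}) ` nb (edges G) v = {e \<in> edges G. v \<in> e}"
    proof
      show "{e \<in> edges G. v \<in> e} \<subseteq> (\<lambda>w. {v, w}) ` nb (edges G) v"
      proof
        fix e assume e: "e \<in> {e \<in> edges G. v \<in> e}"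
        then have "card e = 2" "v \<in> e" using assms by auto
        then obtain w where "e = {v, w}" by (auto simp: card_2_iff)
        then show "e \<in> (\<lambda>w. {v, w}) ` nb (edges G) v" using e by auto
      qed
    qed auto
  qed
  then show ?thesis by (simp add: vertex_degree_def bij_betw_same_card)
qed

lemma connected_graph_closed:
  assumes "connected_graph G" "I \<inter> vertices G \<noteq> {}"
    and "\<And>u v. u \<in> I \<Longrightarrow> {u, v} \<in> edges G \<Longrightarrow> v \<in> I"
  shows "vertices G \<subseteq> I"
proof
  fix v assume v: "v \<in> vertices G"
  obtain u where u: "u \<in> I" "u \<in> vertices G" using assms(2) by auto
  obtain p where p: "graph_walk G p" "hd p = u" "last p = v"
    using assms(1) u v unfolding connected_graph_def by blast
  have "p ! i \<in> I" if "i < length p" for i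
    using that
  proof (induction i)
    case 0
    then show ?case using p u by (simp add: hd_conv_nth[symmetric])
  next
    case (Suc i)
    then show ?case using p(1) assms(3) unfolding graph_walk_def by auto
  qed
  then show "v \<in> I" using p unfolding graph_walk_def
    by (metis last_conv_nth diff_less length_greater_0_conv zero_less_one)
qed

section \<open>Paths, diameter and longest paths in trees\<close>

lemma path_take: "graph_path G p \<Longrightarrow> 0 < j \<Longrightarrow> graph_path G (take j p)"
  using set_take_subset[of j p] unfolding graph_path_def graph_walk_def by auto

lemma connected_graph_path:
  assumes "finite_simple_graph G" "connected_graph G" "u \<in> vertices G" "v \<in> vertices G"
  obtains p where "graph_path G p" "hd p = u" "last p = v"
proof -
  let ?I = "{v. \<exists>p. graph_path G p \<and> hd p = u \<and> last p = v}"
  have "graph_path G [u]" using assms(3) by (simp add: graph_path_def graph_walk_def)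
  then have "u \<in> ?I" by fastforce
  moreover have "w \<in> ?I" if v: "v \<in> ?I" and vw: "{v, w} \<in> edges G" for v w
  proof -
    obtain p where p: "graph_path G p" "hd p = u" "last p = v" using v by blast
    have ne: "p \<noteq> []" using p(1) by (simp add: graph_path_def graph_walk_def)
    show ?thesis
    proof (cases "w \<in> set p")
      \<comment> \<open>Appending a vertex that is already on the path would break distinctness; the
        initial segment ending there serves instead.\<close>
      case True
      then obtain j where j: "j < length p" "w = p ! j" by (auto simp: in_set_conv_nth)
      then have "last (take (Suc j) p) = w" "hd (take (Suc j) p) = u"
        using p ne by (simp_all add: take_Suc_conv_app_nth hd_append hd_conv_nth)
      then show ?thesis using path_take[OF p(1), of "Suc j"] by blast
    next
      case False
      have "w \<in> vertices G" using assms(1) vw unfolding finite_simple_graph_def by blast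
      moreover have "{(p @ [w]) ! i, (p @ [w]) ! Suc i} \<in> edges G" if "Suc i < length (p @ [w])" for i
      proof (cases "Suc i < length p")
        case True
        then show ?thesis using p(1) by (simp add: nth_append graph_path_def graph_walk_def)
      next
        case False
        then have "i = length p - 1" "Suc i = length p" using that by auto
        then show ?thesis using p(3) vw ne by (simp add: nth_append last_conv_nth)
      qed
      ultimately have "graph_path G (p @ [w])"
        using p(1) False unfolding graph_path_def graph_walk_def by auto
      moreover have "hd (p @ [w]) = u" "last (p @ [w]) = w" using p ne by auto
      ultimately show ?thesis by blast
    qed
  qed
  ultimately have "vertices G \<subseteq> ?I"
    using connected_graph_closed[OF assms(2), of ?I] assms(3) by blast
  then show ?thesis using that assms(4) by blast
qed

text \<open>The diameter is an attained maximum of attained minima: finiteness and connectedness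
  make the sets under \<open>Max\<close> and \<open>Inf\<close> finite or nonempty as required. A
  shortest path between two vertices at maximum distance is then long enough.\<close>

lemma long_path_of_diameter:
  assumes "finite_simple_graph G" "connected_graph G" "k < graph_diameter G"
  obtains p where "graph_path G p" "Suc k < length p"
proof -
  let ?S = "{graph_distance G u v | u v. u \<in> vertices G \<and> v \<in> vertices G}"
  have "?S = (\<lambda>(u, v). graph_distance G u v) ` (vertices G \<times> vertices G)" by auto
  then have "finite ?S" "?S \<noteq> {}"
    using assms unfolding finite_simple_graph_def connected_graph_def by auto
  then have "graph_diameter G \<in> ?S" unfolding graph_diameter_def by (rule Max_in)
  then obtain u v where uv: "graph_diameter G = graph_distance G u v" "u \<in> vertices G" "v \<in> vertices G"
    by blast
  let ?D = "{length p - 1 | p. graph_path G p \<and> hd p = u \<and> last p = v}"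
  have "?D \<noteq> {}" using connected_graph_path[OF assms(1,2) uv(2,3)] by blast
  then have "Inf ?D \<in> ?D" by (rule Inf_nat_def1)
  then obtain p where "Inf ?D = length p - 1" "graph_path G p" by blast
  then show ?thesis using that[of p] uv assms(3) unfolding graph_distance_def by auto
qed

lemma path_rev: "graph_path G p \<Longrightarrow> graph_path G (rev p)"
proof -
  assume p: "graph_path G p"
  have "{rev p ! i, rev p ! Suc i} \<in> edges G" if "Suc i < length p" for i
  proof -
    have "Suc (length p - Suc (Suc i)) = length p - Suc i" using that by simp
    moreover have "{p ! (length p - Suc (Suc i)), p ! Suc (length p - Suc (Suc i))} \<in> edges G"
      using p that unfolding graph_path_def graph_walk_def by simp
    ultimately show ?thesis using that by (simp add: rev_nth insert_commute)
  qed
  then show ?thesis using p unfolding graph_path_def graph_walk_def by simp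
qed

lemma path_drop_take:
  assumes "graph_path G p" "i < j" "j \<le> length p"
  shows "graph_path G (drop i (take j p))"
proof -
  have "set (drop i (take j p)) \<subseteq> set p"
    using set_drop_subset set_take_subset by (metis subset_trans)
  then show ?thesis using assms unfolding graph_path_def graph_walk_def by auto
qed

text \<open>A further neighbour of the end vertex would prolong the path if it lay outside, and
  close a cycle if it lay on the path beyond the second vertex.\<close>

lemma longest_path_end:
  assumes "is_tree G" "graph_path G p" "3 \<le> length p"
    and longest: "\<And>p'. graph_path G p' \<Longrightarrow> length p' \<le> length p"
  shows "nb (edges G) (p ! 0) = {p ! 1}"
proof
  have simple: "e \<subseteq> vertices G" "card e = 2" if "e \<in> edges G" for e
    using assms(1) that unfolding is_tree_def finite_simple_graph_def by auto
  have walk: "p \<noteq> []" "set p \<subseteq> vertices G" "distinct p"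
    "\<And>i. Suc i < length p \<Longrightarrow> {p ! i, p ! Suc i} \<in> edges G"
    using assms(2) unfolding graph_path_def graph_walk_def by auto
  show "{p ! 1} \<subseteq> nb (edges G) (p ! 0)" using walk(4)[of 0] assms(3) by simp
  show "nb (edges G) (p ! 0) \<subseteq> {p ! 1}"
  proof
    fix w assume "w \<in> nb (edges G) (p ! 0)"
    then have w: "{p ! 0, w} \<in> edges G" by simp
    have "w \<in> set p"
    proof (rule ccontr)
      assume "w \<notin> set p"
      moreover have "{(w # p) ! i, (w # p) ! Suc i} \<in> edges G" if "Suc i < length (w # p)" for i
        using that w walk(4) by (cases i) (auto simp: insert_commute)
      ultimately have "graph_path G (w # p)"
        using walk simple(1)[OF w] unfolding graph_path_def graph_walk_def by auto
      then show False using longest by fastforce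
    qed
    then obtain j where j: "j < length p" "w = p ! j" by (auto simp: in_set_conv_nth)
    have "j \<noteq> 0"
      using simple(2)[OF w] j by (intro notI) simp
    moreover have "\<not> 2 \<le> j"
    proof
      assume "2 \<le> j"
      let ?c = "take (Suc j) p"
      have "graph_path G ?c" using path_take[OF assms(2)] by simp
      moreover have "length ?c = Suc j" using j by simp
      moreover have "hd ?c = p ! 0" "last ?c = p ! j"
        using j walk(1) by (simp_all add: take_Suc_conv_app_nth hd_append hd_conv_nth)
      ultimately have "graph_cycle G ?c"
        using w j \<open>2 \<le> j\<close> unfolding graph_cycle_def by (simp add: insert_commute)
      then show False using assms(1) unfolding is_tree_def by blast
    qed
    ultimately have "j = 1" by linarith
    then show "w \<in> {p ! 1}" using j by simp
  qed
qed

lemma tree_no_triangle: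
  assumes "is_tree T" "{u, v} \<in> edges T" "{v, w} \<in> edges T"
  shows "{u, w} \<notin> edges T"
proof
  assume uw: "{u, w} \<in> edges T"
  have simple: "e \<subseteq> vertices T" "card e = 2" if "e \<in> edges T" for e
    using assms(1) that unfolding is_tree_def finite_simple_graph_def by auto
  have "u \<noteq> v" "v \<noteq> w" "u \<noteq> w" using simple(2)[OF uw] simple(2)[OF assms(2)] simple(2)[OF assms(3)]
    by (intro notI, simp)+
  moreover have "{[u, v, w] ! i, [u, v, w] ! Suc i} \<in> edges T" if "Suc i < length [u, v, w]" for i
  proof -
    have "i = 0 \<or> i = 1" using that by auto
    then show ?thesis using assms(2,3) by auto
  qed
  ultimately have "graph_cycle T [u, v, w]"
    using uw simple(1)[OF uw] simple(1)[OF assms(2)]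
    unfolding graph_cycle_def graph_path_def graph_walk_def by (simp add: insert_commute)
  then show False using assms(1) unfolding is_tree_def by blast
qed

text \<open>The two non-adjacent branch vertices are the neighbours a and b of the ends of a longest
  path. The ends are leaves, so the degree hypothesis excludes degree 2 for a and b; at least five
  vertices on the path make a and b distinct, and acyclicity makes them non-adjacent.\<close>

lemma branching_tree_of_tree:
  assumes tree: "is_tree T" and diam: "4 \<le> graph_diameter T"
    and leaves: "\<forall>v\<in>vertices T. vertex_degree T v = 2 \<longrightarrow> (\<forall>u. {u, v} \<in> edges T \<longrightarrow> \<not> leaf T u)"
  shows "branching_tree (vertices T) (edges T)"
proof -
  let ?V = "vertices T" and ?E = "edges T"
  have fin: "finite ?V" and simple: "\<And>e. e \<in> ?E \<Longrightarrow> e \<subseteq> ?V \<and> card e = 2" and con: "connected_graph T"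
    and acyclic: "\<And>p. \<not> graph_cycle T p"
    using tree unfolding is_tree_def finite_simple_graph_def by auto
  have deg: "vertex_degree T v = card (nb ?E v)" for v
    by (rule vertex_degree_nb) (simp add: simple)
  have closed: "?V \<subseteq> I" if "I \<inter> ?V \<noteq> {}" "\<And>u v. u \<in> I \<Longrightarrow> {u, v} \<in> ?E \<Longrightarrow> v \<in> I" for I
    by (rule connected_graph_closed[OF con that(1)]) (rule that(2))
  have finnb: "finite (nb ?E v)" for v
  proof (rule finite_subset[OF _ fin])
    show "nb ?E v \<subseteq> ?V" using simple by (auto simp: nb_def)
  qed
  obtain p0 where p0: "graph_path T p0" "5 \<le> length p0"
  proof (rule long_path_of_diameter[of T 3])
    show "finite_simple_graph T" "connected_graph T" using tree by (simp_all add: is_tree_def)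
    show "3 < graph_diameter T" using diam by simp
  qed (simp add: Suc_le_eq)
  have len: "length p \<le> card ?V" if "graph_path T p" for p
    using that fin unfolding graph_path_def graph_walk_def
    by (metis card_mono distinct_card)
  define p where "p = arg_max length (graph_path T)"
  have p: "graph_path T p" and longest: "\<And>p'. graph_path T p' \<Longrightarrow> length p' \<le> length p"
    using arg_max_nat_lemma[of "graph_path T" p0 length "Suc (card ?V)"] p0(1) len
    unfolding p_def by (auto simp: less_Suc_eq_le)
  have plen: "5 \<le> length p" using p0 longest by fastforce
  have leaf_nb: "3 \<le> card (nb ?E v)" if uv: "{u, v} \<in> ?E" and one: "card (nb ?E u) = 1" for u v
  proof (rule ccontr)
    assume "\<not> 3 \<le> card (nb ?E v)"
    have "u \<in> nb ?E v" "v \<in> nb ?E u" using uv by (auto simp: insert_commute)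
    have uV: "u \<in> ?V" "v \<in> ?V" using simple[OF uv] by auto
    then have "leaf T u" using one deg by (simp add: leaf_def)
    then have "card (nb ?E v) \<noteq> 2" using leaves uV uv deg by auto
    moreover have "card (nb ?E v) \<noteq> 0" using \<open>u \<in> nb ?E v\<close> finnb by auto
    ultimately have "card (nb ?E v) = 1" using \<open>\<not> 3 \<le> card (nb ?E v)\<close> by linarith
    then have "nb ?E v = {u}" "nb ?E u = {v}"
      using one \<open>u \<in> nb ?E v\<close> \<open>v \<in> nb ?E u\<close> by (metis card_1_singletonE singletonD)+
    \<comment> \<open>Two adjacent vertices of degree 1 would form a component, hence all of T,
      which is too small for a path with five vertices.\<close>
    then have "y \<in> {u, v}" if "x \<in> {u, v}" "{x, y} \<in> ?E" for x y
      using that unfolding nb_def by blast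
    then have "?V \<subseteq> {u, v}" using closed[of "{u, v}"] uV by blast
    then have "card ?V \<le> 2" using card_mono[of "{u, v}" ?V] by (cases "u = v") auto
    then show False using len[OF p] plen by linarith
  qed
  have ends: "nb ?E (q ! 0) = {q ! 1}" if "q = p \<or> q = rev p" for q
    using longest_path_end[OF tree, of q] that p path_rev[OF p] plen longest by auto
  have walk: "set p \<subseteq> ?V" "distinct p" "\<And>i. Suc i < length p \<Longrightarrow> {p ! i, p ! Suc i} \<in> ?E"
    using p unfolding graph_path_def graph_walk_def by auto
  define a b where "a = p ! 1" and "b = p ! (length p - 2)"
  have rev: "rev p ! 1 = b" unfolding b_def using plen by (simp add: rev_nth numeral_2_eq_2)
  have nba: "nb ?E (p ! 0) = {a}" and nbb: "nb ?E (rev p ! 0) = {b}"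
    using ends[of p] ends[of "rev p"] unfolding rev by (simp_all only: a_def refl simp_thms)
  then have "{p ! 0, a} \<in> ?E" "{rev p ! 0, b} \<in> ?E" unfolding nb_def by blast+
  then have "3 \<le> card (nb ?E a)" "3 \<le> card (nb ?E b)" using leaf_nb nba nbb by fastforce+
  moreover have "a \<noteq> b" unfolding a_def b_def using walk(2) plen by (simp add: nth_eq_iff_index_eq)
  moreover have "{a, b} \<notin> ?E"
  proof
    assume ab: "{a, b} \<in> ?E"
    \<comment> \<open>The longest path without its two ends runs from a to b and has at least three
      vertices, so an edge ab would close it to a cycle.\<close>
    define q where "q = drop 1 (take (length p - 1) p)"
    have pq: "graph_path T q" unfolding q_def using path_drop_take[OF p, of 1 "length p - 1"] plen by simp
    have len: "length q = length p - 2" unfolding q_def by simp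
    have nth: "q ! i = p ! Suc i" if "i < length q" for i
      using that unfolding q_def by simp
    have ne: "q \<noteq> []" using len plen by auto
    have hd: "hd q = a" unfolding a_def using nth[of 0] ne by (simp add: hd_conv_nth)
    have "last q = q ! (length q - 1)" using ne by (rule last_conv_nth)
    also have "\<dots> = p ! Suc (length q - 1)" using ne by (intro nth) simp
    also have "Suc (length q - 1) = length p - 2" using len plen by linarith
    finally have "last q = b" unfolding b_def .
    moreover have "{b, a} \<in> ?E" using ab by (simp add: insert_commute)
    moreover have "3 \<le> length q" using len plen by linarith
    ultimately have "graph_cycle T q" unfolding graph_cycle_def using pq hd by simp
    then show False using acyclic by blast
  qed
  moreover have "a \<in> ?V" "b \<in> ?V"
    unfolding a_def b_def using plen by (auto intro!: subsetD[OF walk(1)] nth_mem)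
  ultimately show ?thesis
    by (intro branching_treeI[OF fin simple closed leaf_nb tree_no_triangle[OF tree]])
qed

lemma branching_tree_isomorphic:
  assumes "finite_simple_graph K" "isomorphic K T" "branching_tree (vertices T) (edges T)"
  shows "branching_tree (vertices K) (edges K)"
proof -
  let ?U = "vertices K" and ?F = "edges K"
  have simple: "e \<subseteq> ?U \<and> card e = 2" if "e \<in> ?F" for e
    using assms(1) that unfolding finite_simple_graph_def by auto
  note T = branching_treeD[OF assms(3)]
  obtain f where f: "bij_betw f ?U (vertices T)"
    and fE: "\<And>u v. u \<in> ?U \<Longrightarrow> v \<in> ?U \<Longrightarrow> {u, v} \<in> ?F \<longleftrightarrow> {f u, f v} \<in> edges T"
    using assms(2) unfolding isomorphic_def by blast
  have inj: "inj_on f ?U" and im: "f ` ?U = vertices T" using f by (auto simp: bij_betw_def)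
  have nbU: "nb ?F v \<subseteq> ?U" for v using simple by fastforce
  have nbT: "nb (edges T) (f v) = f ` nb ?F v" if "v \<in> ?U" for v
  proof
    show "f ` nb ?F v \<subseteq> nb (edges T) (f v)" using fE that simple by (auto simp: nb_def)
    show "nb (edges T) (f v) \<subseteq> f ` nb ?F v"
    proof
      fix y assume "y \<in> nb (edges T) (f v)"
      then have y: "{f v, y} \<in> edges T" by simp
      then have "y \<in> vertices T" using T(2) by blast
      then obtain w where "w \<in> ?U" "y = f w" using im by blast
      then show "y \<in> f ` nb ?F v" using fE that y by auto
    qed
  qed
  have card: "card (nb (edges T) (f v)) = card (nb ?F v)" if "v \<in> ?U" for v
    unfolding nbT[OF that] using inj nbU by (meson card_image inj_on_subset)
  have inU: "u \<in> ?U \<and> v \<in> ?U" if "{u, v} \<in> ?F" for u v using simple[OF that] by auto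
  have closed: "?U \<subseteq> I" if I: "I \<inter> ?U \<noteq> {}" "\<And>u v. u \<in> I \<Longrightarrow> {u, v} \<in> ?F \<Longrightarrow> v \<in> I" for I
  proof -
    \<comment> \<open>The closed set is cut down to \<open>?U\<close> before it is mapped, as f is
      injective only there.\<close>
    let ?J = "f ` (I \<inter> ?U)"
    have "v \<in> ?J" if u: "u \<in> ?J" and uv: "{u, v} \<in> edges T" for u v
    proof -
      obtain u' where u': "u' \<in> I" "u' \<in> ?U" "u = f u'" using u by blast
      then have "v \<in> f ` nb ?F u'" using nbT[OF u'(2)] uv by auto
      then obtain x where "{u', x} \<in> ?F" "v = f x" by auto
      then show ?thesis using I(2)[OF u'(1)] inU by blast
    qed
    moreover have "?J \<inter> vertices T \<noteq> {}" using I(1) im by blast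
    ultimately have "vertices T \<subseteq> ?J" by (intro T(4))
    then have "f ` ?U \<subseteq> f ` (I \<inter> ?U)" using im by simp
    then show ?thesis using inj_on_image_mem_iff[OF inj, of _ "I \<inter> ?U"] by blast
  qed
  have leaf: "3 \<le> card (nb ?F v)" if "{u, v} \<in> ?F" "card (nb ?F u) = 1" for u v
    using T(5)[of "f u" "f v"] that fE[of u v] card inU[OF that(1)] by simp
  have tri: "{u, w} \<notin> ?F" if "{u, v} \<in> ?F" "{v, w} \<in> ?F" for u v w
    using T(6)[of "f u" "f v" "f w"] that fE inU[OF that(1)] inU[OF that(2)] by simp
  obtain a b where ab: "a \<in> vertices T" "b \<in> vertices T" "a \<noteq> b" "{a, b} \<notin> edges T"
      "3 \<le> card (nb (edges T) a)" "3 \<le> card (nb (edges T) b)"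
    using branching_tree_branches[OF assms(3)] .
  obtain a' b' where ab': "a' \<in> ?U" "b' \<in> ?U" "a = f a'" "b = f b'" using ab(1,2) im by blast
  have fin: "finite ?U" using assms(1) by (simp add: finite_simple_graph_def)
  show ?thesis
  proof (rule branching_treeI[OF fin simple closed leaf tri ab'(1,2)])
    show "a' \<noteq> b'" using ab(3) ab' by blast
    show "{a', b'} \<notin> ?F" using ab(4) ab' fE by simp
    show "3 \<le> card (nb ?F a')" "3 \<le> card (nb ?F b')" using ab(5,6) ab' card by simp_all
  qed
qed

section \<open>Leaves of a saturated graph\<close>

lemma proper_colouringD:
  assumes "proper_colouring G c" "e \<in> edges G" "f \<in> edges G" "s \<in> e" "s \<in> f" "c e = c f"
  shows "e = f"
proof (rule ccontr)
  assume "e \<noteq> f"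
  moreover have "e \<inter> f \<noteq> {}" using assms(4,5) by blast
  ultimately show False using assms unfolding proper_colouring_def by simp
qed

text \<open>Turns properness into a condition on one star at a time, the form in which the
  recolourings are checked.\<close>

lemma proper_colouring_iff:
  assumes "finite_simple_graph G"
  shows "proper_colouring G c \<longleftrightarrow> (\<forall>s\<in>vertices G. inj_on (\<lambda>w. c {s, w}) (nb (edges G) s))"
proof
  assume c: "proper_colouring G c"
  have "u = w" if "{s, u} \<in> edges G" "{s, w} \<in> edges G" "c {s, u} = c {s, w}" for s u w
  proof -
    have "{s, u} = {s, w}" by (rule proper_colouringD[OF c that(1,2), of s]) (simp_all add: that)
    then show ?thesis by (auto simp: doubleton_eq_iff)
  qed
  then show "\<forall>s\<in>vertices G. inj_on (\<lambda>w. c {s, w}) (nb (edges G) s)"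
    unfolding inj_on_def nb_def by blast
next
  assume inj: "\<forall>s\<in>vertices G. inj_on (\<lambda>w. c {s, w}) (nb (edges G) s)"
  have other: "\<exists>w. e = {s, w}" if "e \<in> edges G" "s \<in> e" for e s
  proof -
    have "card e = 2" using assms that(1) unfolding finite_simple_graph_def by blast
    then obtain x y where "e = {x, y}" by (auto simp: card_2_iff)
    then show ?thesis using that(2) by (auto simp: insert_commute)
  qed
  have eqI: "e = f" if e: "e \<in> edges G" and f: "f \<in> edges G" and "s \<in> e" "s \<in> f" and eq: "c e = c f" for e f s
  proof -
    obtain u w where uw: "e = {s, u}" "f = {s, w}" using other[OF e \<open>s \<in> e\<close>] other[OF f \<open>s \<in> f\<close>] by blast
    have "s \<in> vertices G" using assms e \<open>s \<in> e\<close> unfolding finite_simple_graph_def by blast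
    then have "u = w" using inj e f eq unfolding uw inj_on_def nb_def by blast
    then show ?thesis using uw by simp
  qed
  then show "proper_colouring G c"
    unfolding proper_colouring_def
  proof (intro ballI impI notI)
    fix e f assume ef: "e \<in> edges G" "f \<in> edges G" "e \<noteq> f \<and> e \<inter> f \<noteq> {}" "c e = c f"
    then obtain s where "s \<in> e" "s \<in> f" by blast
    then show False using eqI[OF ef(1,2) _ _ ef(4)] ef(3) by blast
  qed
qed

section \<open>Rainbow-free colourings and copies created by a new edge\<close>

locale rainbow_saturated =
  fixes G :: "'a graph" and T :: "'b graph"
  assumes simple_graph: "finite_simple_graph G"
    and saturated: "properly_rainbow_saturated G T"
    and branching: "branching_tree (vertices T) (edges T)"
begin

abbreviation "V \<equiv> vertices G"
abbreviation "E \<equiv> edges G"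
abbreviation "N \<equiv> nb (edges G)"

definition L :: "'a set" where "L = {v \<in> V. card (N v) = 1}"
definition W :: "'a set" where "W = V - L"

text \<open>The neighbourhood after the leaves are deleted once; vertices with at most one neighbour
  may remain and are counted by \<open>low\<close>.\<close>

definition H :: "'a \<Rightarrow> 'a set" where "H v = N v - L"

lemma finite_V: "finite V" and edge_subset: "e \<in> E \<Longrightarrow> e \<subseteq> V" and edge_card: "e \<in> E \<Longrightarrow> card e = 2"
  using simple_graph by (auto simp: finite_simple_graph_def)

lemma edge_vertices: "{u, v} \<in> E \<Longrightarrow> u \<in> V \<and> v \<in> V \<and> u \<noteq> v"
  using edge_subset[of "{u, v}"] edge_card[of "{u, v}"] by (cases "u = v") auto

lemma N_subset: "N v \<subseteq> V" and N_irrefl: "v \<notin> N v"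
  using edge_vertices edge_vertices[of v v] by auto

lemma finite_N: "finite (N v)" using N_subset finite_V finite_subset by blast

lemma finite_E: "finite E"
  by (rule finite_subset[of _ "Pow V"]) (use edge_subset finite_V in auto)

lemma finite_W: "finite W" and finite_L: "finite L" and L_subset: "L \<subseteq> V" and W_subset: "W \<subseteq> V"
  using finite_V by (auto simp: W_def L_def)

lemma H_W: "H v \<subseteq> W" and finite_H: "finite (H v)" and H_irrefl: "v \<notin> H v"
  using N_subset finite_N N_irrefl by (auto simp: H_def W_def simp del: nb_iff)

lemma H_iff: "w \<in> H v \<longleftrightarrow> {v, w} \<in> E \<and> w \<in> W"
  using edge_vertices by (auto simp: H_def W_def)

lemma H_sym: "v \<in> W \<Longrightarrow> w \<in> H v \<Longrightarrow> v \<in> H w"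
  by (simp add: H_iff insert_commute)

lemma leaf_unique: "l \<in> L \<Longrightarrow> {l, u} \<in> E \<Longrightarrow> {l, v} \<in> E \<Longrightarrow> u = v"
proof -
  assume "l \<in> L" "{l, u} \<in> E" "{l, v} \<in> E"
  then have "card (N l) = 1" "u \<in> N l" "v \<in> N l" by (auto simp: L_def)
  then show "u = v" by (metis card_1_singletonE singletonD)
qed

lemma proper_iff: "proper_colouring G c \<longleftrightarrow> (\<forall>s\<in>V. inj_on (\<lambda>w. c {s, w}) (N s))"
  using proper_colouring_iff[OF simple_graph] .

lemma proper_eqD: "proper_colouring G c \<Longrightarrow> {s, u} \<in> E \<Longrightarrow> {s, v} \<in> E \<Longrightarrow> c {s, u} = c {s, v} \<Longrightarrow> u = v"
  unfolding proper_iff inj_on_def nb_def using edge_vertices by blast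

definition rainbow_free :: "('a set \<Rightarrow> nat) \<Rightarrow> bool" where
  "rainbow_free c \<longleftrightarrow> proper_colouring G c \<and> \<not> has_rainbow_copy G c T"

text \<open>If no tree that is rainbow under c' contains a recoloured edge, then such a tree is
  rainbow under c as well, so no new copy of T can arise.\<close>

lemma rainbow_free_recolour:
  assumes "rainbow_free c" "proper_colouring G c'"
    and "\<And>U F f. branching_tree U F \<Longrightarrow> U \<subseteq> V \<Longrightarrow> F \<subseteq> E \<Longrightarrow> inj_on c' F \<Longrightarrow> f \<in> F \<Longrightarrow> c' f = c f"
  shows "rainbow_free c'"
  unfolding rainbow_free_def
proof (intro conjI notI assms(2))
  assume "has_rainbow_copy G c' T"
  then obtain K where K: "subgraph K G" "isomorphic K T" "inj_on c' (edges K)"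
    unfolding has_rainbow_copy_def by blast
  then have "branching_tree (vertices K) (edges K)" "vertices K \<subseteq> V" "edges K \<subseteq> E"
    using branching_tree_isomorphic[OF _ _ branching] by (auto simp: subgraph_def)
  then have "c' f = c f" if "f \<in> edges K" for f using assms(3) K(3) that by blast
  then have "inj_on c (edges K)" using K(3) by (simp cong: inj_on_cong)
  then show False using assms(1) K unfolding rainbow_free_def has_rainbow_copy_def by blast
qed

lemma new_copy:
  assumes c: "rainbow_free c" and uv: "u \<in> V" "v \<in> V" "u \<noteq> v" "{u, v} \<notin> E"
  obtains U F where "branching_tree U F" "U \<subseteq> V" "F \<subseteq> insert {u, v} E" "{u, v} \<in> F" "inj_on c (F - {{u, v}})"
proof -
  let ?e = "{u, v}"
  obtain m where m: "m \<notin> c ` E" using ex_new_if_finite[OF infinite_UNIV_nat, of "c ` E"] finite_E by auto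
  let ?d = "c(?e := m)"
  have "proper_colouring (add_edge G ?e) ?d"
    using c m uv(4) unfolding rainbow_free_def proper_colouring_def add_edge_def by auto
  then obtain K where K: "subgraph K (add_edge G ?e)" "isomorphic K T" "inj_on ?d (edges K)"
    using saturated uv unfolding properly_rainbow_saturated_def has_rainbow_copy_def by meson
  have sub: "vertices K \<subseteq> V" "edges K \<subseteq> insert ?e E" "finite_simple_graph K"
    using K(1) by (auto simp: subgraph_def add_edge_def)
  have inj: "inj_on c (edges K - {?e})"
    using K(3) by (auto simp: inj_on_def split: if_splits)
  have "?e \<in> edges K"
  proof (rule ccontr)
    assume "?e \<notin> edges K"
    then have "subgraph K G" "inj_on c (edges K)" using sub inj by (auto simp: subgraph_def)
    then show False using c K(2) unfolding rainbow_free_def has_rainbow_copy_def by blast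
  qed
  then show ?thesis
    using that branching_tree_isomorphic[OF sub(3) K(2) branching] sub inj by blast
qed

lemma nb_new_edge: "F \<subseteq> insert {u, v} E \<Longrightarrow> s \<noteq> u \<Longrightarrow> s \<noteq> v \<Longrightarrow> nb F s \<subseteq> N s"
  "F \<subseteq> insert {u, v} E \<Longrightarrow> nb F u \<subseteq> insert v (N u)"
  unfolding nb_def by (blast dest: doubleton_eq_iff[THEN iffD1])+

lemma card_nb_new_edge:
  assumes "F \<subseteq> insert {u, v} E"
  shows "card (nb F u) \<le> Suc (card (N u))"
proof -
  have "card (nb F u) \<le> card (insert v (N u))"
    using nb_new_edge(2)[OF assms] finite_N by (intro card_mono) auto
  then show ?thesis using card_insert_if[OF finite_N, of v u] by (simp split: if_splits)
qed

text \<open>Joining two leaves forces both pendant edges into the new copy, since a leaf of the tree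
  has a neighbour of degree at least 3.\<close>

lemma new_copy_leaves:
  assumes c: "rainbow_free c" and l: "l \<in> L" "l' \<in> L" "l \<noteq> l'" "{l, l'} \<notin> E"
    and e: "{l, u} \<in> E" "{l', u'} \<in> E"
  shows "u \<noteq> u' \<and> c {l, u} \<noteq> c {l', u'}"
proof -
  have V: "l \<in> V" "l' \<in> V" and Nl: "card (N l) = 1" "card (N l') = 1" using l by (auto simp: L_def)
  obtain U F where F: "branching_tree U F" "U \<subseteq> V" "F \<subseteq> insert {l, l'} E" "{l, l'} \<in> F"
    "inj_on c (F - {{l, l'}})"
    using new_copy[OF c V l(3,4)] .
  have F': "F \<subseteq> insert {l', l} E" "{l', l} \<in> F" using F(3,4) by (simp_all add: insert_commute)
  have "card (nb F l) \<le> 2" "card (nb F l') \<le> 2"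
    using card_nb_new_edge[OF F(3)] card_nb_new_edge[OF F'(1)] Nl by simp_all
  \<comment> \<open>Both ends of the new edge have degree at most 2 in the copy, so neither can be
    the neighbour of a leaf of the copy; hence neither is a leaf of it.\<close>
  then have "card (nb F l) \<noteq> 1" "card (nb F l') \<noteq> 1"
    using branching_treeD(5)[OF F(1) F(4)] branching_treeD(5)[OF F(1) F'(2)] by linarith+
  then have "nb F l \<noteq> {l'}" "nb F l' \<noteq> {l}" by auto
  then obtain w w' where w: "{l, w} \<in> F" "w \<noteq> l'" "{l', w'} \<in> F" "w' \<noteq> l"
    using F(4) F'(2) unfolding nb_def by blast
  then have "{l, w} \<in> E" "{l', w'} \<in> E" using F(3) l(3) by (auto simp: doubleton_eq_iff)
  then have [simp]: "w = u" "w' = u'" using e l leaf_unique by blast+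
  have "u \<noteq> u'" using branching_treeD(6)[OF F(1) F'(2), of u] w by (auto simp: insert_commute)
  moreover have "{l, u} \<noteq> {l', u'}" using l(3) w by (auto simp: doubleton_eq_iff)
  then have "c {l, u} \<noteq> c {l', u'}"
    using inj_onD[OF F(5), of "{l, u}" "{l', u'}"] w l(3) by (auto simp: doubleton_eq_iff)
  ultimately show ?thesis ..
qed

lemma ex_rainbow_free: obtains c where "rainbow_free c"
proof -
  have "\<exists>c. rainbow_free c" using saturated by (simp add: properly_rainbow_saturated_def rainbow_free_def)
  then show ?thesis using that by blast
qed

text \<open>Joining two leaves at a common neighbour would put a triangle into the new copy, as both
  pendant edges are forced into it.\<close>

lemma leaf_nb_unique:
  assumes "l \<in> L" "l' \<in> L" "{v, l} \<in> E" "{v, l'} \<in> E"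
  shows "l = l'"
proof (rule ccontr)
  assume "l \<noteq> l'"
  obtain c where c: "rainbow_free c" by (rule ex_rainbow_free)
  have lv: "{l, v} \<in> E" "{l', v} \<in> E" using assms by (simp_all add: insert_commute)
  have "{l, l'} \<notin> E"
    using leaf_unique[OF assms(1) lv(1), of l'] edge_vertices[OF assms(4)] by auto
  then show False using new_copy_leaves[OF c assms(1,2) \<open>l \<noteq> l'\<close> _ lv] by blast
qed

lemma card_leaf_nb: "card (N v \<inter> L) \<le> 1"
proof -
  have "finite (N v \<inter> L)" using finite_N by blast
  moreover have "l = l'" if "l \<in> N v \<inter> L" "l' \<in> N v \<inter> L" for l l'
    using leaf_nb_unique[of l l' v] that by simp
  ultimately show ?thesis by (simp add: card_le_Suc0_iff_eq)
qed

text \<open>A new edge between two isolated vertices would have two ends of degree 1 in its copy,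
  but the neighbour of a leaf has degree at least 3.\<close>

lemma isolated_le_one: "card {v \<in> V. N v = {}} \<le> 1"
proof -
  have "u = v" if u: "u \<in> V" "N u = {}" and v: "v \<in> V" "N v = {}" for u v
  proof (rule ccontr)
    assume "u \<noteq> v"
    obtain c where c: "rainbow_free c" by (rule ex_rainbow_free)
    have "{u, v} \<notin> E" using u by auto
    then obtain U F where F: "branching_tree U F" "F \<subseteq> insert {u, v} E" "{u, v} \<in> F"
      by (rule new_copy[OF c u(1) v(1) \<open>u \<noteq> v\<close>])
    have F': "F \<subseteq> insert {v, u} E" "{v, u} \<in> F" using F by (simp_all add: insert_commute)
    have "nb F u = {v}" "nb F v = {u}"
      using nb_new_edge(2)[OF F(2)] nb_new_edge(2)[OF F'(1)] u(2) v(2) F(3) F'(2)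
      unfolding nb_def by blast+
    then show False using branching_treeD(5)[OF F(1) F(3)] by simp
  qed
  then show ?thesis using finite_V by (simp add: card_le_Suc0_iff_eq)
qed

text \<open>Leaves whose neighbour has degree at most 2 can be given arbitrary pendant colours,
  as their pendant edges lie in no copy of the tree.\<close>

definition weak_leaves :: "'a set" where
  "weak_leaves = {l \<in> L. \<exists>u. {l, u} \<in> E \<and> card (N u) \<le> 2}"

lemma weak_leaves_adjacent:
  assumes "l \<in> weak_leaves" "l' \<in> weak_leaves" "l \<noteq> l'"
  shows "{l, l'} \<in> E"
proof (rule ccontr)
  assume ll: "{l, l'} \<notin> E"
  obtain u u' where l: "l \<in> L" "l' \<in> L" and e: "{l, u} \<in> E" "{l', u'} \<in> E"
    and deg: "card (N u) \<le> 2" "card (N u') \<le> 2" using assms unfolding weak_leaves_def by blast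
  obtain c where c: "rainbow_free c" by (rule ex_rainbow_free)
  have "u \<noteq> u'" using new_copy_leaves[OF c l assms(3) ll e] by blast
  have ne: "u \<noteq> l'" "u' \<noteq> l" using e ll by (auto simp: insert_commute)
  obtain m where m: "m \<notin> c ` E" using ex_new_if_finite[OF infinite_UNIV_nat, of "c ` E"] finite_E by auto
  \<comment> \<open>Both pendant edges get the same fresh colour. They are disjoint, so this stays
    proper; but a copy through the edge joining the two leaves would need them to differ.\<close>
  let ?d = "c({l, u} := m, {l', u'} := m)"
  have "e = f" if "e \<in> E" "f \<in> E" "e \<inter> f \<noteq> {}" "?d e = ?d f" for e f
  proof -
    have disj: "{l, u} \<inter> {l', u'} = {}" using assms(3) \<open>u \<noteq> u'\<close> ne by auto
    have "c e = c f \<Longrightarrow> e = f"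
      using c that proper_colouringD[of G c e f] unfolding rainbow_free_def by blast
    moreover have "c e \<noteq> m" "c f \<noteq> m" using m that by auto
    ultimately show ?thesis using that(3,4) disj by (auto simp: Int_commute split: if_splits)
  qed
  then have proper: "proper_colouring G ?d" unfolding proper_colouring_def by blast
  have "rainbow_free ?d"
  proof (rule rainbow_free_recolour[OF c proper])
    fix U F f assume F: "branching_tree U F" "F \<subseteq> E" "f \<in> F"
    have *: "{l, u} \<notin> F" if "l \<in> L" "card (N u) \<le> 2" for l u
    proof
      assume lu: "{l, u} \<in> F"
      have sub: "nb F x \<subseteq> N x" for x using F(2) by auto
      have "nb F l = {u}" using lu F(2) leaf_unique[OF that(1)] unfolding nb_def by blast
      then have "3 \<le> card (nb F u)" using branching_treeD(5)[OF F(1) lu] by simp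
      then show False using card_mono[OF finite_N sub, of u] that(2) by simp
    qed
    show "?d f = c f" using *[OF l(1) deg(1)] *[OF l(2) deg(2)] F(3) by auto
  qed
  then have "?d {l, u} \<noteq> ?d {l', u'}" using new_copy_leaves[OF _ l assms(3) ll e] by blast
  moreover have "?d {l, u} = ?d {l', u'}" by simp
  ultimately show False by contradiction
qed

text \<open>Weak leaves are pairwise adjacent and have only one neighbour each, so there is room for
  two.\<close>

lemma card_weak_leaves: "card weak_leaves \<le> 2"
proof (cases "weak_leaves = {}")
  case False
  then obtain l where l: "l \<in> weak_leaves" by blast
  then have "l \<in> L" by (simp add: weak_leaves_def)
  have "weak_leaves \<subseteq> insert l (N l)" using weak_leaves_adjacent[OF l] by (auto simp: nb_def)
  then have "card weak_leaves \<le> card (insert l (N l))" using finite_N by (intro card_mono) auto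
  also have "\<dots> \<le> Suc (card (N l))" using card_insert_if[OF finite_N] by simp
  finally show ?thesis using \<open>l \<in> L\<close> by (simp add: L_def)
qed simp

section \<open>Zones\<close>

definition with_leaves :: "'a set \<Rightarrow> 'a set" where
  "with_leaves S = S \<union> (\<Union>v\<in>S. N v \<inter> L)"

text \<open>Tests only steps to non-leaves; the leaves are added afterwards by
  \<open>with_leaves\<close>.\<close>

definition closed_in :: "'a set set \<Rightarrow> 'a set \<Rightarrow> bool" where
  "closed_in F S \<longleftrightarrow> (\<forall>u\<in>S. \<forall>w\<in>W. {u, w} \<in> F \<longrightarrow> w \<in> S)"

text \<open>The alternative \<open>\<not> H v \<subseteq> Z\<close> lets border vertices keep their
  old pendant colours. This is harmless: a vertex of degree at least 3 in a tree confined to Z uses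
  all its non-leaf neighbours, so these lie in Z.\<close>

definition region :: "('a set \<Rightarrow> nat) \<Rightarrow> 'a set \<Rightarrow> nat \<Rightarrow> bool" where
  "region c Z C \<longleftrightarrow> Z \<subseteq> W \<and> (\<forall>v\<in>Z. card (H v) = 2) \<and>
     (\<forall>v\<in>Z. (\<forall>l\<in>N v \<inter> L. c {v, l} = C) \<or> \<not> H v \<subseteq> Z)"

text \<open>The centre \<open>x\<close> has the two non-leaf neighbours \<open>p\<close> and \<open>q\<close>, and the colours
  alternate around it: \<open>A\<close> on \<open>xp\<close> is repeated next to \<open>q\<close>, and \<open>B\<close> on \<open>xq\<close>
  is repeated next to \<open>p\<close> (in a triangle \<open>x p q\<close> the edge \<open>pq\<close> is exempt). The last condition
  says that a rainbow tree through \<open>x\<close> cannot leave \<open>Z\<close> and its pendant edges.\<close>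

definition zone :: "('a set \<Rightarrow> nat) \<Rightarrow> 'a \<Rightarrow> 'a \<Rightarrow> 'a \<Rightarrow> 'a set \<Rightarrow> nat \<Rightarrow> nat \<Rightarrow> nat \<Rightarrow> bool" where
  "zone c x p q Z A B C \<longleftrightarrow> region c Z C \<and> x \<in> Z \<and> p \<in> Z \<and> q \<in> Z \<and> p \<noteq> q \<and> H x = {p, q} \<and>
     c {x, p} = A \<and> c {x, q} = B \<and>
     (\<forall>w\<in>H p. w \<noteq> x \<and> w \<noteq> q \<longrightarrow> c {p, w} = B) \<and>
     (\<forall>w\<in>H q. w \<noteq> x \<and> w \<noteq> p \<longrightarrow> c {q, w} = A) \<and>
     (\<forall>F\<subseteq>E. inj_on c F \<longrightarrow> (\<exists>S. x \<in> S \<and> S \<subseteq> Z \<and> closed_in F S))"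

lemma regionD:
  assumes "region c Z C"
  shows "Z \<subseteq> W" "v \<in> Z \<Longrightarrow> card (H v) = 2"
    and "v \<in> Z \<Longrightarrow> H v \<subseteq> Z \<Longrightarrow> {v, l} \<in> E \<Longrightarrow> l \<in> L \<Longrightarrow> c {v, l} = C"
  using assms by (auto simp: region_def nb_def)

lemma zoneD:
  assumes "zone c x p q Z A B C"
  shows "region c Z C" "x \<in> Z" "p \<in> Z" "q \<in> Z" "p \<noteq> q" "H x = {p, q}" "c {x, p} = A" "c {x, q} = B"
    and "w \<in> H p \<Longrightarrow> w \<noteq> x \<Longrightarrow> w \<noteq> q \<Longrightarrow> c {p, w} = B"
    and "w \<in> H q \<Longrightarrow> w \<noteq> x \<Longrightarrow> w \<noteq> p \<Longrightarrow> c {q, w} = A"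
  using assms by (simp_all add: zone_def)

lemma zone_closed_in:
  assumes "zone c x p q Z A B C" "F \<subseteq> E" "inj_on c F"
  shows "\<exists>S. x \<in> S \<and> S \<subseteq> Z \<and> closed_in F S"
  using assms by (simp add: zone_def)

lemma W_L_disjoint: "W \<inter> L = {}"
  by (auto simp: W_def)

lemma N_split: "N v = H v \<union> (N v \<inter> L)"
  by (auto simp: H_def)

lemma nb_subset_N: "F \<subseteq> E \<Longrightarrow> nb F v \<subseteq> N v"
  by (auto simp: nb_def)

lemma with_leaves_closed:
  assumes "S \<subseteq> W" "F \<subseteq> E" "closed_in F S" "u \<in> with_leaves S" "{u, v} \<in> F"
  shows "v \<in> with_leaves S"
proof -
  have uv: "{u, v} \<in> E" using assms by blast
  show ?thesis
  proof (cases "u \<in> S")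
    case True
    show ?thesis
    proof (cases "v \<in> L")
      case True
      then have "v \<in> N u \<inter> L" using uv by (simp add: nb_def)
      then show ?thesis using \<open>u \<in> S\<close> unfolding with_leaves_def by blast
    next
      case False
      then have "v \<in> W" using edge_vertices[OF uv] by (simp add: W_def)
      then show ?thesis using assms(3,5) True unfolding closed_in_def with_leaves_def by blast
    qed
  next
    case False
    then obtain s where s: "s \<in> S" "u \<in> N s" "u \<in> L" using assms(4) unfolding with_leaves_def by blast
    then have "v = s" using leaf_unique[OF s(3) uv, of s] by (simp add: insert_commute)
    then show ?thesis using s(1) by (simp add: with_leaves_def)
  qed
qed

text \<open>In a region a vertex has two non-leaf neighbours and at most one leaf, so degree 3 in F
  uses them all. Closedness then puts both non-leaf neighbours into Z, where the pendant colour is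
  C.\<close>

lemma branch_pendant:
  assumes Z: "region c Z C" and S: "S \<subseteq> Z" "closed_in F S" and F: "F \<subseteq> E"
    and u: "u \<in> with_leaves S" "3 \<le> card (nb F u)"
  shows "u \<in> S \<and> (\<exists>l\<in>L. {u, l} \<in> F \<and> c {u, l} = C)"
proof -
  have sub: "nb F u \<subseteq> N u" using nb_subset_N[OF F] .
  then have le: "card (nb F u) \<le> card (N u)" by (rule card_mono[OF finite_N])
  have "u \<notin> L" using le u(2) by (auto simp: L_def)
  then have uS: "u \<in> S" using u(1) by (auto simp: with_leaves_def)
  then have uZ: "u \<in> Z" using S(1) by blast
  have H2: "card (H u) = 2" using Z uZ by (simp add: region_def)
  have split: "nb F u = (nb F u \<inter> H u) \<union> (nb F u \<inter> L)" using sub N_split[of u] by blast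
  have "card (nb F u) \<le> card (nb F u \<inter> H u) + card (nb F u \<inter> L)"
    by (subst split) (rule card_Un_le)
  moreover have "card (nb F u \<inter> H u) \<le> 2" using card_mono[OF finite_H, of "nb F u \<inter> H u" u] H2 by simp
  moreover have "card (nb F u \<inter> L) \<le> card (N u \<inter> L)" using sub finite_N by (intro card_mono) auto
  ultimately have "card (nb F u \<inter> L) \<noteq> 0" and HF: "card (nb F u \<inter> H u) = card (H u)"
    using u(2) card_leaf_nb[of u] H2 by linarith+
  then have "nb F u \<inter> L \<noteq> {}" by auto
  then obtain l where l: "l \<in> L" "{u, l} \<in> F" by (auto simp: nb_def)
  have "nb F u \<inter> H u = H u" using HF by (intro card_subset_eq[OF finite_H]) auto
  then have "H u \<subseteq> S"
    using S(2) uS H_W[of u] unfolding closed_in_def nb_def by blast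
  then have "H u \<subseteq> Z" using S(1) by blast
  moreover have "l \<in> N u \<inter> L" using l F by (auto simp: nb_def)
  ultimately have "c {u, l} = C" using Z uZ unfolding region_def by blast
  then show ?thesis using uS l by blast
qed

text \<open>A confined copy has two branch vertices, each with a pendant edge of colour C. Being
  rainbow it would have to use one edge for both, which makes one of the branch vertices a
  leaf.\<close>

lemma no_copy_in_region:
  assumes Z: "region c Z C" and F: "branching_tree U F" "F \<subseteq> E" "inj_on c F"
    and S: "S \<subseteq> Z" "closed_in F S" "S \<inter> U \<noteq> {}"
  shows False
proof -
  have SW: "S \<subseteq> W" using S(1) Z by (auto simp: region_def)
  have "with_leaves S \<inter> U \<noteq> {}" using S(3) by (auto simp: with_leaves_def)
  then have U: "U \<subseteq> with_leaves S"
    by (rule branching_treeD(4)[OF F(1)]) (rule with_leaves_closed[OF SW F(2) S(2)])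
  obtain a b where ab: "a \<in> U" "b \<in> U" "a \<noteq> b" "3 \<le> card (nb F a)" "3 \<le> card (nb F b)"
    by (rule branching_tree_branches[OF F(1)])
  obtain l l' where l: "a \<in> S" "l \<in> L" "{a, l} \<in> F" "c {a, l} = C"
    and l': "b \<in> S" "l' \<in> L" "{b, l'} \<in> F" "c {b, l'} = C"
    using branch_pendant[OF Z S(1,2) F(2)] ab U by blast
  have "{a, l} = {b, l'}" using inj_onD[OF F(3)] l l' by simp
  then have "a = l'" using ab(3) by (auto simp: doubleton_eq_iff)
  then show False using l(1) l'(2) SW W_L_disjoint by blast
qed

text \<open>Lets a zone survive the recolouring of another zone disjoint from it.\<close>

lemma zone_cong:
  assumes "zone c x p q Z A B C" "\<And>f. f \<in> E \<Longrightarrow> f \<inter> Z \<noteq> {} \<Longrightarrow> c' f = c f"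
  shows "zone c' x p q Z A B C"
proof -
  note z = zoneD[OF assms(1)]
  have eq: "c' {v, w} = c {v, w}" if "v \<in> Z" "{v, w} \<in> E" for v w
    by (rule assms(2)) (use that in auto)
  have HE: "{v, w} \<in> E" if "w \<in> H v" for v w using that by (simp add: H_iff)
  have "region c' Z C"
    unfolding region_def
  proof (intro conjI ballI)
    show "Z \<subseteq> W" and "\<And>v. v \<in> Z \<Longrightarrow> card (H v) = 2" using regionD[OF z(1)] by blast+
    show "(\<forall>l\<in>N v \<inter> L. c' {v, l} = C) \<or> \<not> H v \<subseteq> Z" if "v \<in> Z" for v
    proof (cases "H v \<subseteq> Z")
      case True
      then have "c' {v, l} = C" if "l \<in> N v \<inter> L" for l
        using regionD(3)[OF z(1) \<open>v \<in> Z\<close>, of l] eq[OF \<open>v \<in> Z\<close>, of l] that by simp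
      then show ?thesis by blast
    qed simp
  qed
  moreover have "c' {x, p} = A" "c' {x, q} = B"
    using eq[OF z(2) HE, of p] eq[OF z(2) HE, of q] z(6,7,8) by simp_all
  moreover have "\<forall>w\<in>H p. w \<noteq> x \<and> w \<noteq> q \<longrightarrow> c' {p, w} = B" using z(9) eq[OF z(3) HE] by simp
  moreover have "\<forall>w\<in>H q. w \<noteq> x \<and> w \<noteq> p \<longrightarrow> c' {q, w} = A" using z(10) eq[OF z(4) HE] by simp
  moreover have "\<exists>S. x \<in> S \<and> S \<subseteq> Z \<and> closed_in F S" if F: "F \<subseteq> E" "inj_on c' F" for F
  proof -
    \<comment> \<open>The two colourings agree only on edges meeting Z, so F is first cut down to
      these; closedness of a subset of Z depends on no other edges.\<close>
    let ?F = "{f \<in> F. f \<inter> Z \<noteq> {}}"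
    have "inj_on c ?F"
    proof (rule inj_onI)
      fix e f assume ef: "e \<in> ?F" "f \<in> ?F" "c e = c f"
      have "c' e = c e" "c' f = c f" using ef(1,2) F(1) by (auto intro!: assms(2))
      then show "e = f" using inj_onD[OF F(2), of e f] ef by simp
    qed
    moreover have "?F \<subseteq> E" using F by blast
    ultimately have "\<exists>S. x \<in> S \<and> S \<subseteq> Z \<and> closed_in ?F S" by (intro zone_closed_in[OF assms(1)])
    then obtain S where S: "x \<in> S" "S \<subseteq> Z" "closed_in ?F S" by blast
    then have "closed_in F S" unfolding closed_in_def by blast
    then show ?thesis using S by blast
  qed
  ultimately show ?thesis unfolding zone_def using z(2-6) by simp
qed

text \<open>Each set is closed only for the old edges; the new edge merely leads from one set to the
  other, so their union confines the copy.\<close>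

lemma new_copy_within:
  assumes F: "branching_tree U F" "F \<subseteq> insert {x, y} E" "{x, y} \<in> F"
    and S: "x \<in> S" "S \<subseteq> W" "closed_in (F - {{x, y}}) S"
    and S': "y \<in> S'" "S' \<subseteq> W" "closed_in (F - {{x, y}}) S'"
  shows "U \<subseteq> with_leaves S \<union> with_leaves S'"
proof (rule branching_treeD(4)[OF F(1)])
  have FE: "F - {{x, y}} \<subseteq> E" using F(2) by blast
  have in': "x \<in> with_leaves S" "y \<in> with_leaves S'" using S(1) S'(1) by (simp_all add: with_leaves_def)
  then show "(with_leaves S \<union> with_leaves S') \<inter> U \<noteq> {}"
    using branching_treeD(2)[OF F(1,3)] by blast
  show "v \<in> with_leaves S \<union> with_leaves S'" if u: "u \<in> with_leaves S \<union> with_leaves S'" and uv: "{u, v} \<in> F" for u v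
  proof (cases "{u, v} = {x, y}")
    case True
    then have "v \<in> {x, y}" by blast
    then show ?thesis using in' by blast
  next
    case False
    then have "{u, v} \<in> F - {{x, y}}" using uv by blast
    then show ?thesis
      using u with_leaves_closed[OF S(2) FE S(3), of u v] with_leaves_closed[OF S'(2) FE S'(3), of u v] by blast
  qed
qed

text \<open>A new edge between the centres of two zones: its copy of the tree cannot leave the zones, so
  every vertex of degree at least 3 other than the centres uses a pendant edge of the colour
  \<open>C\<close>. Hence one of two such non-adjacent vertices is a centre.\<close>

lemma no_branching_centre:
  assumes zx: "zone c x p q Z A B C" and zy: "zone c y p' q' Z' A B C" and disj: "Z \<inter> Z' = {}"
    and F: "branching_tree U F" "F \<subseteq> insert {x, y} E" "{x, y} \<in> F" "inj_on c (F - {{x, y}})"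
    and S: "x \<in> S" "S \<subseteq> Z" "closed_in (F - {{x, y}}) S"
    and S': "y \<in> S'" "S' \<subseteq> Z'" "closed_in (F - {{x, y}}) S'"
    and x3: "3 \<le> card (nb F x)" and b: "b \<in> U" "b \<noteq> x" "b \<noteq> y" "{x, b} \<notin> F" "3 \<le> card (nb F b)"
  shows False
proof -
  let ?F = "F - {{x, y}}"
  have FE: "?F \<subseteq> E" using F(2) by blast
  have rx: "region c Z C" and ry: "region c Z' C" and xZ: "x \<in> Z" and yZ: "y \<in> Z'"
    and Hx: "H x = {p, q}" and Hy: "H y = {p', q'}" and pq: "p \<in> Z" "q \<in> Z" "p \<noteq> q"
    using zoneD(1-6)[OF zx] zoneD(1-6)[OF zy] by simp_all
  have ZW: "Z \<subseteq> W" "Z' \<subseteq> W" using regionD(1) rx ry by blast+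
  have SW: "S \<subseteq> W" "S' \<subseteq> W" using S S' ZW by auto
  have new: "{u, v} \<in> ?F \<or> u = x \<and> v = y \<or> u = y \<and> v = x" if "{u, v} \<in> F" for u v
    using that by (auto simp: doubleton_eq_iff)
  have "b \<in> with_leaves S \<union> with_leaves S'"
    using new_copy_within[OF F(1-3) S(1) SW(1) S(3) S'(1) SW(2) S'(3)] b(1) by blast
  moreover have "nb ?F b = nb F b" using b(2,3) by (auto simp: nb_def doubleton_eq_iff)
  then have "3 \<le> card (nb ?F b)" using b(5) by simp
  ultimately obtain l where bS: "b \<in> S \<or> b \<in> S'" and l: "l \<in> L" "{b, l} \<in> ?F" "c {b, l} = C"
    using branch_pendant[OF rx S(2,3) FE] branch_pendant[OF ry S'(2,3) FE] by blast
  have bW: "b \<in> W" using bS SW by blast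
  have xW: "x \<in> W" using xZ ZW by blast
  \<comment> \<open>A pendant edge at x would repeat the colour C of the pendant edge at b. So x has
    degree exactly 3, and its edges to p and q spend both A and B.\<close>
  have "nb F x \<subseteq> {y, p, q}"
  proof
    fix w assume "w \<in> nb F x"
    then have w: "{x, w} \<in> F" by simp
    show "w \<in> {y, p, q}"
    proof (rule ccontr)
      assume neg: "w \<notin> {y, p, q}"
      then have wF: "{x, w} \<in> ?F" using new[OF w] by auto
      then have "w \<in> N x" using FE by (auto simp: nb_def)
      then have wL: "w \<in> N x \<inter> L" using N_split[of x] Hx neg by blast
      moreover have "H x \<subseteq> Z" using Hx pq by simp
      ultimately have "c {x, w} = C" using regionD(3)[OF rx xZ] by (simp add: nb_def)
      then have "{x, w} = {b, l}" using inj_onD[OF F(4) _ wF l(2)] l(3) by simp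
      then have "x = l" using b(2) by (auto simp: doubleton_eq_iff)
      then show False using l(1) xW W_L_disjoint by blast
    qed
  qed
  moreover have "card {y, p, q} \<le> 3" by (simp add: card_insert_if)
  ultimately have "nb F x = {y, p, q}" using x3 by (intro card_seteq) auto
  then have xpF: "{x, p} \<in> F" "{x, q} \<in> F" by (auto simp: nb_def)
  have yp: "y \<noteq> p" "y \<noteq> q" "x \<noteq> y" using yZ pq xZ disj by auto
  then have xp: "{x, p} \<in> ?F" "{x, q} \<in> ?F" using xpF by (auto simp: doubleton_eq_iff)
  have cx: "c {x, p} = A" "c {x, q} = B" and cy: "c {y, p'} = A" "c {y, q'} = B" using zoneD(7,8)[OF zx] zoneD(7,8)[OF zy] by simp_all
  have bx: "b \<noteq> p" "b \<noteq> q" using b(4) xpF by auto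
  show False
  proof (cases "b \<in> S")
    case True
    have xne: "p \<noteq> x" "q \<noteq> x" using H_irrefl[of x] Hx by auto
    \<comment> \<open>The edges leading on from p and q have the colours B and A, both spent at x.
      Thus on this side the tree ends at p and q, leaving no place for b.\<close>
    have "closed_in ?F {x, p, q}"
      unfolding closed_in_def
    proof (intro ballI impI)
      fix u w assume uw: "u \<in> {x, p, q}" "w \<in> W" "{u, w} \<in> ?F"
      then have wH: "w \<in> H u" using FE by (auto simp: H_iff)
      show "w \<in> {x, p, q}"
      proof (rule ccontr)
        assume neg: "w \<notin> {x, p, q}"
        then have "u = p \<or> u = q" using uw(1) wH Hx by auto
        then show False
        proof
          assume "u = p"
          then have "c {p, w} = B" using zoneD(9)[OF zx] wH neg by simp
          then have "{p, w} = {x, q}" using inj_onD[OF F(4) _ _ xp(2)] cx uw(3) \<open>u = p\<close> by simp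
          then show False using xne pq by (auto simp: doubleton_eq_iff)
        next
          assume "u = q"
          then have "c {q, w} = A" using zoneD(10)[OF zx] wH neg by simp
          then have "{q, w} = {x, p}" using inj_onD[OF F(4) _ _ xp(1)] cx uw(3) \<open>u = q\<close> by simp
          then show False using xne pq by (auto simp: doubleton_eq_iff)
        qed
      qed
    qed
    moreover have "{x, p, q} \<subseteq> W" using xW pq ZW by blast
    ultimately have "U \<subseteq> with_leaves {x, p, q} \<union> with_leaves S'"
      by (intro new_copy_within[OF F(1-3) _ _ _ S'(1) SW(2) S'(3)]) simp_all
    then have "b \<in> {x, p, q} \<union> L \<union> S'" using b(1) unfolding with_leaves_def by blast
    then show False using b(2) bx bW W_L_disjoint True S(2) S'(2) disj by blast
  next
    case False
    then have bS': "b \<in> S'" using bS by blast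
    \<comment> \<open>If b lies on the side of y, connectedness requires an old edge of the copy
      from y into its zone; its colour A or B is already spent at x.\<close>
    have "\<not> U \<subseteq> with_leaves S \<union> with_leaves {y}"
    proof
      assume "U \<subseteq> with_leaves S \<union> with_leaves {y}"
      then have "b \<in> S \<union> {y} \<union> L" using b(1) unfolding with_leaves_def by blast
      then show False using False b(3) bW W_L_disjoint by blast
    qed
    moreover have "{y} \<subseteq> W" using yZ ZW by blast
    ultimately have "\<not> closed_in ?F {y}"
      using new_copy_within[OF F(1-3) S(1) SW(1) S(3), of "{y}"] by blast
    then obtain w where w: "w \<in> W" "{y, w} \<in> ?F" unfolding closed_in_def by blast
    then have "w \<in> H y" using FE by (auto simp: H_iff)
    then have "w = p' \<or> w = q'" using Hy by blast
    then have "{y, w} = {x, p} \<or> {y, w} = {x, q}"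
      using inj_onD[OF F(4) _ w(2) xp(1)] inj_onD[OF F(4) _ w(2) xp(2)] cx cy by auto
    then show False using yp by (auto simp: doubleton_eq_iff)
  qed
qed

text \<open>The centres are non-adjacent because a zone contains the non-leaf neighbours of its
  centre, so they can be joined. In the resulting copy neither of two non-adjacent branch vertices
  is a centre, by \<open>no_branching_centre\<close> used in both directions; hence each has a
  pendant edge of colour C, which a rainbow copy cannot afford.\<close>

lemma no_two_zones:
  assumes c: "rainbow_free c" and zx: "zone c x p q Z A B C" and zy: "zone c y p' q' Z' A B C"
    and disj: "Z \<inter> Z' = {}"
  shows False
proof -
  have rx: "region c Z C" and ry: "region c Z' C" and xZ: "x \<in> Z" and yZ: "y \<in> Z'"
    and Hx: "H x = {p, q}" and pq: "p \<in> Z" "q \<in> Z"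
    using zoneD(1-6)[OF zx] zoneD(1-6)[OF zy] by simp_all
  have ZW: "Z \<subseteq> W" "Z' \<subseteq> W" using regionD(1) rx ry by blast+
  have "x \<noteq> y" using xZ yZ disj by blast
  have nE: "{x, y} \<notin> E"
  proof
    assume "{x, y} \<in> E"
    then have "y \<in> H x" using yZ ZW by (auto simp: H_iff)
    then have "y = p \<or> y = q" unfolding Hx by simp
    then have "y \<in> Z" using pq by auto
    then show False using yZ disj by blast
  qed
  have V: "x \<in> V" "y \<in> V" using xZ yZ ZW W_subset by auto
  obtain U F where F: "branching_tree U F" "F \<subseteq> insert {x, y} E" "{x, y} \<in> F"
    "inj_on c (F - {{x, y}})"
    by (rule new_copy[OF c V \<open>x \<noteq> y\<close> nE])
  let ?F = "F - {{x, y}}"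
  have swap: "{y, x} = {x, y}" by (rule insert_commute)
  have FE: "?F \<subseteq> E" using F(2) by blast
  obtain S where S: "x \<in> S" "S \<subseteq> Z" "closed_in ?F S" using zone_closed_in[OF zx FE F(4)] by blast
  obtain S' where S': "y \<in> S'" "S' \<subseteq> Z'" "closed_in ?F S'" using zone_closed_in[OF zy FE F(4)] by blast
  have SW: "S \<subseteq> W" "S' \<subseteq> W" using S S' ZW by auto
  obtain a b where ab: "a \<in> U" "b \<in> U" "a \<noteq> b" "{a, b} \<notin> F" "3 \<le> card (nb F a)" "3 \<le> card (nb F b)"
    by (rule branching_tree_branches[OF F(1)])
  have ba: "{b, a} \<notin> F" using ab(4) by (simp add: insert_commute)
  have cx: False if t: "3 \<le> card (nb F x)" "t \<in> U" "t \<noteq> x" "{x, t} \<notin> F" "3 \<le> card (nb F t)" for t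
  proof -
    have "t \<noteq> y" using F(3) t(4) by blast
    then show False using no_branching_centre[OF zx zy disj F S S' t(1-3) _ t(4,5)] by blast
  qed
  have F': "F \<subseteq> insert {y, x} E" "{y, x} \<in> F" "inj_on c (F - {{y, x}})"
    "closed_in (F - {{y, x}}) S" "closed_in (F - {{y, x}}) S'"
    unfolding swap using F(2,3,4) S(3) S'(3) by simp_all
  have cy: False if t: "3 \<le> card (nb F y)" "t \<in> U" "t \<noteq> y" "{y, t} \<notin> F" "3 \<le> card (nb F t)" for t
  proof -
    have "t \<noteq> x" using F'(2) t(4) by blast
    moreover have "Z' \<inter> Z = {}" using disj by blast
    ultimately show False
      using no_branching_centre[OF zy zx _ F(1) F'(1-3) S'(1,2) F'(5) S(1,2) F'(4) t(1-3) _ t(4,5)] by blast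
  qed
  have ne: "a \<noteq> x" "a \<noteq> y" "b \<noteq> x" "b \<noteq> y"
    using cx[of b] cy[of b] cx[of a] cy[of a] ab ba by metis+
  have U: "U \<subseteq> with_leaves S \<union> with_leaves S'"
    using new_copy_within[OF F(1-3) S(1) SW(1) S(3) S'(1) SW(2) S'(3)] .
  have pendant: "u \<in> W \<and> (\<exists>l\<in>L. {u, l} \<in> ?F \<and> c {u, l} = C)"
    if "u \<in> U" "u \<noteq> x" "u \<noteq> y" "3 \<le> card (nb F u)" for u
  proof -
    have "nb ?F u = nb F u" using that(2,3) by (auto simp: nb_def doubleton_eq_iff)
    then show ?thesis
      using branch_pendant[OF rx S(2,3) FE, of u] branch_pendant[OF ry S'(2,3) FE, of u] that SW
        U by auto
  qed
  obtain l l' where l: "a \<in> W" "{a, l} \<in> ?F" "c {a, l} = C"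
    and l': "l' \<in> L" "{b, l'} \<in> ?F" "c {b, l'} = C"
    using pendant[OF ab(1) ne(1,2) ab(5)] pendant[OF ab(2) ne(3,4) ab(6)] by blast
  have "{a, l} = {b, l'}" using inj_onD[OF F(4) _ l(2) l'(2)] l(3) l'(3) by simp
  then have "a = l'" using ab(3) by (auto simp: doubleton_eq_iff)
  then show False using l(1) l'(1) W_L_disjoint by blast
qed

section \<open>Recolouring cycles and paths\<close>

text \<open>The statement ranges over all rainbow-free c and all colours absent near Z, and confines
  the change to Z and pendant edges, so that two disjoint sets can be treated in succession with the
  same three colours.\<close>

definition colourable :: "'a \<Rightarrow> 'a \<Rightarrow> 'a \<Rightarrow> 'a set \<Rightarrow> bool" where
  "colourable x p q Z \<longleftrightarrow> (\<forall>c A B C. rainbow_free c \<longrightarrow> A \<noteq> B \<longrightarrow> A \<noteq> C \<longrightarrow> B \<noteq> C \<longrightarrow>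
     (\<forall>f\<in>E. f \<inter> Z \<noteq> {} \<longrightarrow> c f \<notin> {A, B, C}) \<longrightarrow>
     (\<exists>c'. rainbow_free c' \<and> (\<forall>f\<in>E. \<not> f \<subseteq> Z \<union> L \<longrightarrow> c' f = c f) \<and> zone c' x p q Z A B C))"

text \<open>With two non-leaf neighbours and at most one leaf, three distinct colours make the star
  proper.\<close>

lemma inj_on_star:
  assumes "H s = {a, b}" "\<And>l. l \<in> L \<Longrightarrow> {s, l} \<in> E \<Longrightarrow> c {s, l} = C"
    and "c {s, a} \<noteq> c {s, b}" "c {s, a} \<noteq> C" "c {s, b} \<noteq> C"
  shows "inj_on (\<lambda>w. c {s, w}) (N s)"
proof (rule inj_onI)
  fix u w assume uw: "u \<in> N s" "w \<in> N s" "c {s, u} = c {s, w}"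
  have E: "{s, u} \<in> E" "{s, w} \<in> E" using uw(1,2) by simp_all
  have *: "v \<in> L \<or> v = a \<or> v = b" if "v \<in> N s" for v
    using that N_split[of s] assms(1) by blast
  have "u \<in> L \<longleftrightarrow> w \<in> L"
    using *[OF uw(1)] *[OF uw(2)] assms(2)[OF _ E(1)] assms(2)[OF _ E(2)] uw(3) assms(4,5) by metis
  then show "u = w"
    using *[OF uw(1)] *[OF uw(2)] leaf_nb_unique[OF _ _ E] uw(3) assms(3) by metis
qed

lemma inj_on_leaf: "s \<in> L \<Longrightarrow> inj_on f (N s)"
  using leaf_unique by (auto simp: inj_on_def nb_def)

lemma inj_on_unchanged:
  assumes "rainbow_free c" "\<And>w. {s, w} \<in> E \<Longrightarrow> c' {s, w} = c {s, w}"
  shows "inj_on (\<lambda>w. c' {s, w}) (N s)"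
proof (rule inj_onI)
  fix u w assume "u \<in> N s" "w \<in> N s" "c' {s, u} = c' {s, w}"
  moreover have "proper_colouring G c" using assms(1) by (simp add: rainbow_free_def)
  ultimately show "u = w" using proper_eqD[of c s u w] assms(2)[of u] assms(2)[of w] by simp
qed

text \<open>Here Z is a union of components of the graph without leaves, so a tree meeting Z stays
  in Z and its pendant edges. All of Z can therefore be recoloured, and
  \<open>no_copy_in_region\<close> excludes every rainbow copy touching it.\<close>

lemma colourable_closed:
  assumes Z: "Z \<subseteq> W" "\<And>v. v \<in> Z \<Longrightarrow> card (H v) = 2" "\<And>v. v \<in> Z \<Longrightarrow> H v \<subseteq> Z"
    and x: "x \<in> Z" "H x = {p, q}" "p \<noteq> q"
  shows "colourable x p q Z"
  unfolding colourable_def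
proof (intro allI impI)
  fix c :: "'a set \<Rightarrow> nat" and A B C :: nat
  assume c: "rainbow_free c" and ABC: "A \<noteq> B" "A \<noteq> C" "B \<noteq> C"
  obtain g :: "'a set \<Rightarrow> nat" where g: "inj_on g E"
    using finite_imp_inj_to_nat_seg[OF finite_E] by blast
  \<comment> \<open>The default colours exceed A, B and C and are distinct on E; the edge pq of a
    triangle gets one of them. In a four-cycle the vertex opposite x sees both A and B, which still
    differ.\<close>
  define d where "d f = (if f = {x, p} then A else if f = {x, q} then B
    else if p \<in> f \<and> q \<notin> f then B else if q \<in> f \<and> p \<notin> f then A else Suc (A + B + C + g f))" for f
  define c' where "c' f = (if f \<inter> Z = {} then c f else if f \<inter> L \<noteq> {} then C else d f)" for f
  have ZL: "Z \<inter> L = {}" using Z(1) W_L_disjoint by blast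
  have pq: "p \<in> Z" "q \<in> Z" using Z(3)[OF x(1)] x(2) by auto
  have pqW: "p \<in> W" "q \<in> W" "x \<in> W" using pq x(1) Z(1) by blast+
  have xne: "x \<noteq> p" "x \<noteq> q" using H_irrefl[of x] x(2) by auto
  have nbx: "x \<in> H p" "x \<in> H q" using H_sym[OF pqW(3), of p] H_sym[OF pqW(3), of q] x(2) by auto
  have inH: "w \<in> H v" if "{v, w} \<in> E" "w \<in> W" for v w using that by (simp add: H_iff)
  have edge: "{v, w} \<in> E" "w \<in> Z" "w \<notin> L" if "v \<in> Z" "w \<in> H v" for v w
  proof -
    show "{v, w} \<in> E" using that(2) by (simp add: H_iff)
    show "w \<in> Z" using that Z(3) by blast
    then show "w \<notin> L" using ZL by blast
  qed
  have cd: "c' {v, w} = d {v, w}" if "v \<in> Z" "w \<in> H v" for v w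
    using edge[OF that] ZL that by (auto simp: c'_def)
  have cL: "c' {v, l} = C" if "v \<in> Z" "l \<in> L" for v l
    using that by (auto simp: c'_def)
  have dC: "d f \<noteq> C" for f using ABC by (auto simp: d_def)
  have un: "c' f = c f" if f: "f \<in> E" "\<not> f \<subseteq> Z \<union> L" for f
  proof -
    have "f \<inter> Z = {}"
    proof (rule ccontr)
      assume "f \<inter> Z \<noteq> {}"
      then obtain v where v: "v \<in> f" "v \<in> Z" by blast
      moreover obtain s t where st: "f = {s, t}" using edge_card[OF f(1)] by (auto simp: card_2_iff)
      ultimately obtain w where w: "f = {v, w}" by (auto simp: insert_commute)
      have "w \<in> V" using edge_vertices f(1) w by blast
      then have "w \<in> Z \<union> L" using edge(2)[OF v(2)] inH[of v w] f(1) w by (auto simp: W_def)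
      then show False using f(2) w v by auto
    qed
    then show ?thesis by (simp add: c'_def)
  qed
  have dne: "d {s, a} \<noteq> d {s, b}" if s: "s \<in> Z" "H s = {a, b}" "a \<noteq> b" for s a b
  proof -
    have "{s, a} \<in> E" "{s, b} \<in> E" using edge[OF s(1)] s(2) by auto
    moreover have "{s, a} \<noteq> {s, b}" using s(3) by (auto simp: doubleton_eq_iff)
    ultimately have gne: "g {s, a} \<noteq> g {s, b}" using inj_onD[OF g] by blast
    have sne: "s \<noteq> a" "s \<noteq> b" using H_irrefl[of s] s(2) by auto
    consider "s = x" | "s = p" "a = x \<or> b = x" | "s = q" "a = x \<or> b = x" | "s \<noteq> x" "s \<noteq> p" "s \<noteq> q" "a \<noteq> x" "b \<noteq> x"
    proof -
      have "x \<notin> H s" if "s \<noteq> p" "s \<noteq> q"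
        using H_sym[of s x] s(1) Z(1) x(2) that by auto
      then show ?thesis using that nbx s(2) by (cases "s = p"; cases "s = q") auto
    qed
    then show ?thesis
    proof cases
      case 1
      then have "a = p \<and> b = q \<or> a = q \<and> b = p" using s(2) x(2) by (simp add: doubleton_eq_iff) metis
      then show ?thesis using 1 ABC x(3) xne by (auto simp: d_def doubleton_eq_iff)
    next
      case 2
      then show ?thesis using ABC x(3) xne s(3) sne by (auto simp: d_def doubleton_eq_iff)
    next
      case 3
      then show ?thesis using ABC x(3) xne s(3) sne by (auto simp: d_def doubleton_eq_iff)
    next
      case 4
      then show ?thesis using ABC x(3) s(3) gne by (auto simp: d_def doubleton_eq_iff)
    qed
  qed
  have "inj_on (\<lambda>w. c' {s, w}) (N s)" if sV: "s \<in> V" for s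
  proof -
    consider "s \<in> L" | "s \<in> Z" | "s \<in> W" "s \<notin> Z" using sV unfolding W_def by blast
    then show ?thesis
    proof cases
      case 2
      obtain a b where ab: "H s = {a, b}" "a \<noteq> b" using Z(2)[OF 2] by (auto simp: card_2_iff)
      have cda: "c' {s, a} = d {s, a}" "c' {s, b} = d {s, b}" using cd[OF 2] ab by auto
      show ?thesis
        by (rule inj_on_star[OF ab(1), of c' C]) (use cL[OF 2] dne[OF 2 ab] dC cda in auto)
    next
      case 3
      have "c' {s, w} = c {s, w}" if "{s, w} \<in> E" for w
        by (rule un[OF that]) (use 3 W_L_disjoint in auto)
      then show ?thesis by (rule inj_on_unchanged[OF c])
    qed (rule inj_on_leaf)
  qed
  then have proper: "proper_colouring G c'" by (simp add: proper_iff)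
  have region: "region c' Z C"
    unfolding region_def using Z cL by auto
  have closed: "closed_in F Z" if "F \<subseteq> E" for F
    unfolding closed_in_def using that inH Z(3) by blast
  have "rainbow_free c'"
  proof (rule rainbow_free_recolour[OF c proper])
    fix U F f assume F: "branching_tree U F" "F \<subseteq> E" "inj_on c' F" "f \<in> F"
    have "f \<inter> Z = {}"
    proof (rule ccontr)
      assume "f \<inter> Z \<noteq> {}"
      then have "Z \<inter> U \<noteq> {}" using branching_treeD(2)[OF F(1,4)] by blast
      then show False using no_copy_in_region[OF region F(1-3) _ closed[OF F(2)]] by blast
    qed
    then show "c' f = c f" by (simp add: c'_def)
  qed
  moreover have "zone c' x p q Z A B C"
    unfolding zone_def
  proof (intro conjI ballI allI impI region x pq)
    have "p \<in> H x" "q \<in> H x" using x(2) by auto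
    then show "c' {x, p} = A" "c' {x, q} = B"
      using cd[OF x(1)] x(3) by (auto simp: d_def doubleton_eq_iff)
    show "c' {p, w} = B" if "w \<in> H p" "w \<noteq> x \<and> w \<noteq> q" for w
      using cd[OF pq(1) that(1)] that(2) x(3) xne by (auto simp: d_def doubleton_eq_iff)
    show "c' {q, w} = A" if "w \<in> H q" "w \<noteq> x \<and> w \<noteq> p" for w
      using cd[OF pq(2) that(1)] that(2) x(3) xne by (auto simp: d_def doubleton_eq_iff)
    show "\<exists>S. x \<in> S \<and> S \<subseteq> Z \<and> closed_in F S" if "F \<subseteq> E" for F
      using closed[OF that] x(1) by blast
  qed
  ultimately show "\<exists>c'. rainbow_free c' \<and> (\<forall>f\<in>E. \<not> f \<subseteq> Z \<union> L \<longrightarrow> c' f = c f) \<and> zone c' x p q Z A B C"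
    using un by blast
qed

text \<open>The path \<open>p5 p4 p3 p2 p1 x q1 q2 q3 q4 q5\<close> receives the colours
  \<open>\<gamma> \<delta> \<gamma> B A B A \<gamma>' \<delta>' \<gamma>'\<close>, where the outer two colours on each side are the
  old ones. No rainbow copy enters the recoloured part from outside, as it would need two edges
  of colour \<open>\<gamma>\<close> or a pendant edge next to its last vertex.\<close>

lemma colourable_path:
  assumes dist: "distinct [x, p1, p2, p3, p4, q1, q2, q3, q4]"
    and Zdef: "Z = {x, p1, p2, p3, p4, q1, q2, q3, q4}" and ZW: "Z \<subseteq> W"
    and Hx: "H x = {p1, q1}"
    and Hp: "H p1 = {x, p2}" "H p2 = {p1, p3}" "H p3 = {p2, p4}" "H p4 = {p3, p5}"
    and Hq: "H q1 = {x, q2}" "H q2 = {q1, q3}" "H q3 = {q2, q4}" "H q4 = {q3, q5}"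
    and out: "p5 \<notin> Z" "q5 \<notin> Z"
  shows "colourable x p1 q1 Z"
  unfolding colourable_def
proof (intro allI impI)
  fix c :: "'a set \<Rightarrow> nat" and A B C :: nat
  assume c: "rainbow_free c" and ABC: "A \<noteq> B" "A \<noteq> C" "B \<noteq> C"
    and fresh: "\<forall>f\<in>E. f \<inter> Z \<noteq> {} \<longrightarrow> c f \<notin> {A, B, C}"
  \<comment> \<open>R omits p4 and q4: their pendant edges keep the old colours, so the stars of all
    non-leaves outside R are unchanged and properness needs a new check only on R.\<close>
  define R where "R = {x, p1, p2, p3, q1, q2, q3}"
  define c' where "c' f = (if f \<inter> R \<noteq> {} \<and> f \<inter> L \<noteq> {} then C
    else if f = {x, p1} then A else if f = {x, q1} then B
    else if f = {p1, p2} then B else if f = {q1, q2} then A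
    else if f = {p2, p3} then c {p4, p5} else if f = {q2, q3} then c {q4, q5} else c f)" for f
  have RZ: "R \<subseteq> Z" by (auto simp: R_def Zdef)
  have ZL: "Z \<inter> L = {}" using ZW W_L_disjoint by blast
  have nL: "x \<notin> L" "p1 \<notin> L" "p2 \<notin> L" "p3 \<notin> L" "p4 \<notin> L" "q1 \<notin> L" "q2 \<notin> L" "q3 \<notin> L" "q4 \<notin> L"
    using ZL by (auto simp: Zdef)
  have p5: "p5 \<notin> L" "p5 \<noteq> x" "p5 \<noteq> p1" "p5 \<noteq> p2" "p5 \<noteq> p3" "p5 \<noteq> p4" "p5 \<noteq> q1" "p5 \<noteq> q2" "p5 \<noteq> q3" "p5 \<noteq> q4"
    using out(1) H_W[of p4] Hp(4) W_L_disjoint by (auto simp: Zdef)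
  have q5: "q5 \<notin> L" "q5 \<noteq> x" "q5 \<noteq> p1" "q5 \<noteq> p2" "q5 \<noteq> p3" "q5 \<noteq> p4" "q5 \<noteq> q1" "q5 \<noteq> q2" "q5 \<noteq> q3" "q5 \<noteq> q4"
    using out(2) H_W[of q4] Hq(4) W_L_disjoint by (auto simp: Zdef)
  have d: "x \<noteq> p1" "x \<noteq> p2" "x \<noteq> p3" "x \<noteq> p4" "x \<noteq> q1" "x \<noteq> q2" "x \<noteq> q3" "x \<noteq> q4"
    "p1 \<noteq> p2" "p1 \<noteq> p3" "p1 \<noteq> p4" "p1 \<noteq> q1" "p1 \<noteq> q2" "p1 \<noteq> q3" "p1 \<noteq> q4"
    "p2 \<noteq> p3" "p2 \<noteq> p4" "p2 \<noteq> q1" "p2 \<noteq> q2" "p2 \<noteq> q3" "p2 \<noteq> q4"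
    "p3 \<noteq> p4" "p3 \<noteq> q1" "p3 \<noteq> q2" "p3 \<noteq> q3" "p3 \<noteq> q4"
    "p4 \<noteq> q1" "p4 \<noteq> q2" "p4 \<noteq> q3" "p4 \<noteq> q4"
    "q1 \<noteq> q2" "q1 \<noteq> q3" "q1 \<noteq> q4" "q2 \<noteq> q3" "q2 \<noteq> q4" "q3 \<noteq> q4"
    using dist by auto
  note ne = d d[symmetric] p5 p5(2-)[symmetric] q5 q5(2-)[symmetric] nL
  have inH: "w \<in> H v" if "{v, w} \<in> E" "w \<in> W" for v w using that by (simp add: H_iff)
  have HE: "{v, w} \<in> E" if "w \<in> H v" for v w using that by (simp add: H_iff)
  have cx: "c' {x, p1} = A" "c' {x, q1} = B" "c' {p1, x} = A" "c' {q1, x} = B"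
    and cp: "c' {p1, p2} = B" "c' {p2, p1} = B" "c' {p2, p3} = c {p4, p5}" "c' {p3, p2} = c {p4, p5}"
      "c' {p3, p4} = c {p4, p3}" "c' {p4, p5} = c {p4, p5}"
    and cq: "c' {q1, q2} = A" "c' {q2, q1} = A" "c' {q2, q3} = c {q4, q5}" "c' {q3, q2} = c {q4, q5}"
      "c' {q3, q4} = c {q4, q3}" "c' {q4, q5} = c {q4, q5}"
    using ne by (simp_all add: c'_def R_def doubleton_eq_iff insert_commute)
  have old: "c {p4, p5} \<notin> {A, B, C}" "c {p4, p3} \<notin> {A, B, C}" "c {q4, q5} \<notin> {A, B, C}" "c {q4, q3} \<notin> {A, B, C}"
    using fresh HE[of p5 p4] HE[of p3 p4] HE[of q5 q4] HE[of q3 q4] Hp Hq by (simp_all add: Zdef)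
  have cproper: "proper_colouring G c" using c by (simp add: rainbow_free_def)
  \<comment> \<open>At p3 the edges to p2 and p4 now carry the old colours of p4p5 and p3p4, which
    differ because c is proper at p4; likewise at q3.\<close>
  have old_ne: "c {p4, p5} \<noteq> c {p4, p3}" "c {q4, q5} \<noteq> c {q4, q3}"
    using proper_eqD[OF cproper, of p4 p5 p3] proper_eqD[OF cproper, of q4 q5 q3]
      HE[of p5 p4] HE[of p3 p4] HE[of q5 q4] HE[of q3 q4] Hp Hq ne by auto
  have cL: "c' {v, l} = C" if "v \<in> R" "l \<in> L" for v l
    using that by (auto simp: c'_def)
  have un: "c' f = c f" if "f \<inter> R = {}" for f
    using that by (auto simp: c'_def R_def)
  have unL: "c' f = c f" if "f \<inter> L = {}" "f \<notin> {{x, p1}, {x, q1}, {p1, p2}, {q1, q2}, {p2, p3}, {q2, q3}}" for f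
    using that by (simp add: c'_def)
  have un_out: "c' f = c f" if f: "f \<in> E" "\<not> f \<subseteq> Z \<union> L" for f
  proof (cases "f \<inter> R = {}")
    case False
    have "f \<inter> L = {}"
    proof (rule ccontr)
      assume "f \<inter> L \<noteq> {}"
      then obtain v l where "v \<in> f" "v \<in> R" "l \<in> f" "l \<in> L" using False by blast
      moreover have "v \<noteq> l" using calculation RZ ZL by blast
      ultimately have "f = {v, l}" using edge_card[OF f(1)] by (auto simp: card_2_iff)
      then show False using f(2) \<open>v \<in> R\<close> \<open>l \<in> L\<close> RZ by auto
    qed
    then show ?thesis using f(2) by (intro unL) (auto simp: Zdef)
  qed (rule un)
  have "inj_on (\<lambda>w. c' {s, w}) (N s)" if "s \<in> V" for s
  proof -
    consider "s \<in> L" | "s \<in> R" | "s \<notin> L" "s \<notin> R" by blast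
    then show ?thesis
    proof cases
      case 2
      note star = inj_on_star[of s _ _ c' C]
      have pend: "\<And>l. l \<in> L \<Longrightarrow> {s, l} \<in> E \<Longrightarrow> c' {s, l} = C" using cL[OF 2] by blast
      from 2 consider "s = x" | "s = p1" | "s = p2" | "s = p3" | "s = q1" | "s = q2" | "s = q3"
        by (auto simp: R_def)
      then show ?thesis
      proof cases
        case 1
        show ?thesis by (rule star[where a = p1 and b = q1, OF _ pend]) (use 1 Hx cx ABC in simp_all)
      next
        case 2
        show ?thesis by (rule star[where a = x and b = p2, OF _ pend]) (use 2 Hp cx cp ABC in simp_all)
      next
        case 3
        show ?thesis by (rule star[where a = p1 and b = p3, OF _ pend]) (use 3 Hp cp ABC old in auto)
      next
        case 4
        show ?thesis by (rule star[where a = p2 and b = p4, OF _ pend]) (use 4 Hp cp ABC old old_ne in auto)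
      next
        case 5
        show ?thesis by (rule star[where a = x and b = q2, OF _ pend]) (use 5 Hq cx cq ABC in simp_all)
      next
        case 6
        show ?thesis by (rule star[where a = q1 and b = q3, OF _ pend]) (use 6 Hq cq ABC old in auto)
      next
        case 7
        show ?thesis by (rule star[where a = q2 and b = q4, OF _ pend]) (use 7 Hq cq ABC old old_ne in auto)
      qed
    next
      case 3
      have "c' {s, w} = c {s, w}" if "{s, w} \<in> E" for w
      proof (cases "w \<in> L")
        case True
        then show ?thesis using 3(2) RZ ZL by (intro un) auto
      next
        case False
        then show ?thesis using 3 by (intro unL) (auto simp: R_def doubleton_eq_iff)
      qed
      then show ?thesis by (rule inj_on_unchanged[OF c])
    qed (rule inj_on_leaf)
  qed
  then have proper: "proper_colouring G c'" by (simp add: proper_iff)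
  have region: "region c' Z C"
    unfolding region_def
  proof (intro conjI ballI ZW)
    show "card (H v) = 2" if "v \<in> Z" for v
      using that unfolding Zdef by (elim insertE emptyE) (simp_all add: Hx Hp Hq ne)
    show "(\<forall>l\<in>N v \<inter> L. c' {v, l} = C) \<or> \<not> H v \<subseteq> Z" if "v \<in> Z" for v
    proof (cases "v \<in> R")
      case True
      then show ?thesis using cL by blast
    next
      case False
      then have "v = p4 \<or> v = q4" using that by (auto simp: Zdef R_def)
      then show ?thesis using Hp(4) Hq(4) out by auto
    qed
  qed
  have closed: "\<exists>S. {x, p1, p2, q1, q2} \<subseteq> S \<and> S \<subseteq> Z \<and> closed_in F S"
    if F: "F \<subseteq> E" "inj_on c' F" for F
  proof -
    \<comment> \<open>The two edges share a colour under c', so a rainbow F lacks one of them and is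
      cut off at p2 or at p4.\<close>
    have p: "\<not> ({p2, p3} \<in> F \<and> {p4, p5} \<in> F)"
      using inj_onD[OF F(2), of "{p2, p3}" "{p4, p5}"] cp ne by (auto simp: doubleton_eq_iff)
    have q: "\<not> ({q2, q3} \<in> F \<and> {q4, q5} \<in> F)"
      using inj_onD[OF F(2), of "{q2, q3}" "{q4, q5}"] cq ne by (auto simp: doubleton_eq_iff)
    let ?S = "{x, p1, p2, q1, q2} \<union> (if {p2, p3} \<in> F then {p3, p4} else {}) \<union> (if {q2, q3} \<in> F then {q3, q4} else {})"
    have "closed_in F ?S"
      unfolding closed_in_def
    proof (intro ballI impI)
      fix u w assume u: "u \<in> ?S" and w: "w \<in> W" "{u, w} \<in> F"
      have wH: "w \<in> H u" using w F(1) inH by blast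
      consider "u \<in> {x, p1, q1}" | "u = p2" | "u = q2" | "u = p3" "{p2, p3} \<in> F" | "u = p4" "{p2, p3} \<in> F"
        | "u = q3" "{q2, q3} \<in> F" | "u = q4" "{q2, q3} \<in> F"
        using u by (auto split: if_splits)
      then show "w \<in> ?S"
      proof cases
        case 1
        then show ?thesis using wH Hx Hp(1) Hq(1) by auto
      next
        case 2
        then show ?thesis using wH Hp(2) w(2) by auto
      next
        case 3
        then show ?thesis using wH Hq(2) w(2) by auto
      next
        case 4
        then show ?thesis using wH Hp(3) by auto
      next
        case 5
        then show ?thesis using wH Hp(4) w(2) p by auto
      next
        case 6
        then show ?thesis using wH Hq(3) by auto
      next
        case 7
        then show ?thesis using wH Hq(4) w(2) q by auto
      qed
    qed
    moreover have "?S \<subseteq> Z" by (auto simp: Zdef)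
    ultimately show ?thesis by (intro exI[of _ ?S]) auto
  qed
  have "rainbow_free c'"
  proof (rule rainbow_free_recolour[OF c proper])
    fix U F f assume F: "branching_tree U F" "U \<subseteq> V" "F \<subseteq> E" "inj_on c' F" "f \<in> F"
    show "c' f = c f"
    proof (rule ccontr)
      assume neq: "c' f \<noteq> c f"
      obtain S where S: "{x, p1, p2, q1, q2} \<subseteq> S" "S \<subseteq> Z" "closed_in F S" using closed[OF F(3,4)] by blast
      have fU: "f \<subseteq> U" using branching_treeD(2)[OF F(1,5)] .
      \<comment> \<open>A recoloured edge has an end among these five unless it is pendant at p3 or
        q3. There the leaf forces degree at least 3, so the copy also contains p2 or q2.\<close>
      have "{x, p1, p2, q1, q2} \<inter> U \<noteq> {}"
      proof (cases "f \<inter> L = {}")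
        case True
        then have "f \<in> {{x, p1}, {x, q1}, {p1, p2}, {q1, q2}, {p2, p3}, {q2, q3}}" using unL[OF True] neq by meson
        then show ?thesis using fU by auto
      next
        case False
        then obtain l where l: "l \<in> f" "l \<in> L" by blast
        have "f \<inter> R \<noteq> {}" using un[of f] neq by auto
        then obtain v where v: "v \<in> f" "v \<in> R" by blast
        have "v \<noteq> l" using l v RZ ZL by blast
        then have fvl: "f = {v, l}" using edge_card[of f] F(3,5) v l by (auto simp: card_2_iff)
        have lv: "{l, v} \<in> F" using F(5) fvl by (simp add: insert_commute)
        then have "nb F l = {v}" using leaf_unique[OF l(2), of v] F(3) unfolding nb_def by blast
        then have v3: "3 \<le> card (nb F v)" using branching_treeD(5)[OF F(1) lv] by simp
        have end_nb: "r \<in> U" if "v = s" "H s = {r, t}" for r s t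
        proof (rule ccontr)
          assume r: "r \<notin> U"
          have "nb F v \<subseteq> {t, l}"
          proof
            fix w assume w: "w \<in> nb F v"
            then have vw: "{v, w} \<in> F" by simp
            then have "w \<in> U" "{v, w} \<in> E" using branching_treeD(2)[OF F(1) vw] F(3) by auto
            moreover have "w = l" if "w \<in> L"
              using leaf_nb_unique[of w l v] that l(2) \<open>{v, w} \<in> E\<close> F(3,5) fvl by blast
            ultimately have "w = l \<or> w \<in> H v" by (auto simp: H_def nb_def)
            then show "w \<in> {t, l}" using that r \<open>w \<in> U\<close> by auto
          qed
          then have "card (nb F v) \<le> card {t, l}" by (intro card_mono) auto
          also have "\<dots> \<le> 2" by (simp add: card_insert_if)
          finally show False using v3 by simp
        qed
        have vU: "v \<in> U" using fU v by blast
        from v(2) have "v \<in> {x, p1, p2, q1, q2} \<or> v = p3 \<or> v = q3" by (auto simp: R_def)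
        then show ?thesis using vU end_nb[OF _ Hp(3)] end_nb[OF _ Hq(3)] by blast
      qed
      then have "S \<inter> U \<noteq> {}" using S(1) by blast
      then show False using no_copy_in_region[OF region F(1,3,4) S(2,3)] by blast
    qed
  qed
  moreover have "zone c' x p1 q1 Z A B C"
    unfolding zone_def
  proof (intro conjI ballI allI impI region Hx)
    show "x \<in> Z" "p1 \<in> Z" "q1 \<in> Z" "p1 \<noteq> q1" using d by (auto simp: Zdef)
    show "c' {x, p1} = A" "c' {x, q1} = B" by (rule cx)+
    show "c' {p1, w} = B" if "w \<in> H p1" "w \<noteq> x \<and> w \<noteq> q1" for w using that Hp(1) cp by auto
    show "c' {q1, w} = A" if "w \<in> H q1" "w \<noteq> x \<and> w \<noteq> p1" for w using that Hq(1) cq by auto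
    show "\<exists>S. x \<in> S \<and> S \<subseteq> Z \<and> closed_in F S" if "F \<subseteq> E" "inj_on c' F" for F
      using closed[OF that] by blast
  qed
  ultimately show "\<exists>c'. rainbow_free c' \<and> (\<forall>f\<in>E. \<not> f \<subseteq> Z \<union> L \<longrightarrow> c' f = c f) \<and> zone c' x p1 q1 Z A B C"
    using un_out by blast
qed

section \<open>Vertices far from branch vertices\<close>

text \<open>The ball of radius k, in the graph without leaves, around its vertices of degree other
  than 2.\<close>

primrec near :: "nat \<Rightarrow> 'a set" where
  "near 0 = {v \<in> W. card (H v) \<noteq> 2}"
| "near (Suc k) = near k \<union> {v \<in> W. H v \<inter> near k \<noteq> {}}"

text \<open>Steps are taken only from vertices of degree 2. This bounds the size by that of a binary
  tree of depth k, whatever the degrees elsewhere.\<close>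

primrec reach :: "nat \<Rightarrow> 'a \<Rightarrow> 'a set" where
  "reach 0 v = {v}"
| "reach (Suc k) v = insert v (if card (H v) = 2 then \<Union>(reach k ` H v) else {})"

lemma reach_self: "v \<in> reach k v"
  by (cases k) auto

lemma reach_step: "card (H v) = 2 \<Longrightarrow> w \<in> H v \<Longrightarrow> x \<in> reach k w \<Longrightarrow> x \<in> reach (Suc k) v"
  by auto

lemma reach_Suc: "x \<in> reach k v \<Longrightarrow> x \<in> reach (Suc k) v"
proof (induction k arbitrary: v)
  case (Suc k)
  show ?case
  proof (cases "x = v")
    case False
    then have "card (H v) = 2" "x \<in> \<Union>(reach k ` H v)" using Suc.prems by (simp_all split: if_splits)
    then obtain w where "card (H v) = 2" "w \<in> H v" "x \<in> reach (Suc k) w" using Suc.IH by blast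
    then show ?thesis by (rule reach_step)
  qed (simp only: reach_self)
qed auto

lemma reach_mono: "x \<in> reach k v \<Longrightarrow> k \<le> n \<Longrightarrow> x \<in> reach n v"
  by (rule lift_Suc_mono_le[of "\<lambda>k. reach k v", THEN subsetD]) (auto dest: reach_Suc simp del: reach.simps)

lemma card_reach: "finite (reach k v) \<and> card (reach k v) \<le> 2 ^ Suc k - 1"
proof (induction k arbitrary: v)
  case (Suc k)
  show ?case
  proof (cases "card (H v) = 2")
    case True
    let ?U = "\<Union>(reach k ` H v)"
    have "card ?U \<le> (\<Sum>w\<in>H v. card (reach k w))" by (rule card_UN_le[OF finite_H])
    also have "\<dots> \<le> (\<Sum>w\<in>H v. 2 ^ Suc k - 1)" by (rule sum_mono) (use Suc in blast)
    also have "\<dots> = 2 * (2 ^ Suc k - 1)" using True by simp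
    finally have "card (insert v ?U) \<le> Suc (2 * (2 ^ Suc k - 1))"
      using card_insert_le_m1[of "Suc (2 * (2 ^ Suc k - 1))" ?U v] by simp
    moreover have "finite ?U" using Suc finite_H by blast
    moreover have "Suc (2 * (n - 1)) = 2 * n - 1" if "1 \<le> n" for n :: nat using that by linarith
    then have "Suc (2 * (2 ^ Suc k - 1)) = 2 * 2 ^ Suc k - (1::nat)" using one_le_power[of "2::nat" "Suc k"] by simp
    ultimately show ?thesis using True by simp
  next
    case False
    have "1 \<le> (2::nat) ^ k" by simp
    then have "1 \<le> 2 * 2 ^ Suc k - (1::nat)" unfolding power_Suc by linarith
    then show ?thesis using False by simp
  qed
qed simp

lemma other_neighbour:
  assumes "card (H v) = 2" "u \<in> H v"
  obtains w where "H v = {u, w}" "w \<noteq> u"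
proof -
  obtain a b where "H v = {a, b}" "a \<noteq> b" using assms(1) by (auto simp: card_2_iff)
  then show ?thesis using assms(2) that[of a] that[of b] by (auto simp: insert_commute)
qed

text \<open>A vertex far from all branch vertices lies on a cycle of length at most 9 or is the centre of
  a path with nine vertices, none of which is a branch vertex.\<close>

lemma deep_zone:
  assumes x: "x \<in> W" "x \<notin> near 4"
  obtains p q Z where "colourable x p q Z" "Z \<subseteq> W" "x \<in> Z" "finite Z" "card Z \<le> 9"
    "Z \<subseteq> {z. x \<in> reach 4 z}"
proof -
  note result = that
  have far: "card (H v) = 2" if "v \<in> W" "v \<notin> near k" for v k
    using that by (induction k) auto
  have far_nb: "w \<in> W" "w \<notin> near k" "v \<in> H w" if "v \<in> W" "v \<notin> near (Suc k)" "w \<in> H v" for v w k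
    using that H_W[of v] H_sym[of v w] by auto
  have far4: "x \<notin> near (Suc (Suc (Suc (Suc 0))))" using x(2) by (simp add: eval_nat_numeral)
  obtain p1 q1 where Hx: "H x = {p1, q1}" "p1 \<noteq> q1" using far[OF x] by (auto simp: card_2_iff)
  have p1: "p1 \<in> W" "p1 \<notin> near (Suc (Suc (Suc 0)))" "x \<in> H p1"
    and q1: "q1 \<in> W" "q1 \<notin> near (Suc (Suc (Suc 0)))" "x \<in> H q1"
    using far_nb[OF x(1) far4] Hx by auto
  obtain p2 where Hp1: "H p1 = {x, p2}" "p2 \<noteq> x" using other_neighbour[OF far[OF p1(1,2)] p1(3)] .
  obtain q2 where Hq1: "H q1 = {x, q2}" "q2 \<noteq> x" using other_neighbour[OF far[OF q1(1,2)] q1(3)] .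
  have p2: "p2 \<in> W" "p2 \<notin> near (Suc (Suc 0))" "p1 \<in> H p2" using far_nb[OF p1(1,2)] Hp1 by auto
  have q2: "q2 \<in> W" "q2 \<notin> near (Suc (Suc 0))" "q1 \<in> H q2" using far_nb[OF q1(1,2)] Hq1 by auto
  obtain p3 where Hp2: "H p2 = {p1, p3}" "p3 \<noteq> p1" using other_neighbour[OF far[OF p2(1,2)] p2(3)] .
  obtain q3 where Hq2: "H q2 = {q1, q3}" "q3 \<noteq> q1" using other_neighbour[OF far[OF q2(1,2)] q2(3)] .
  have p3: "p3 \<in> W" "p3 \<notin> near (Suc 0)" "p2 \<in> H p3" using far_nb[OF p2(1,2)] Hp2 by auto
  have q3: "q3 \<in> W" "q3 \<notin> near (Suc 0)" "q2 \<in> H q3" using far_nb[OF q2(1,2)] Hq2 by auto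
  obtain p4 where Hp3: "H p3 = {p2, p4}" "p4 \<noteq> p2" using other_neighbour[OF far[OF p3(1,2)] p3(3)] .
  obtain q4 where Hq3: "H q3 = {q2, q4}" "q4 \<noteq> q2" using other_neighbour[OF far[OF q3(1,2)] q3(3)] .
  have p4: "p4 \<in> W" "p4 \<notin> near 0" "p3 \<in> H p4" using far_nb[OF p3(1,2)] Hp3 by auto
  have q4: "q4 \<in> W" "q4 \<notin> near 0" "q3 \<in> H q4" using far_nb[OF q3(1,2)] Hq3 by auto
  obtain p5 where Hp4: "H p4 = {p3, p5}" "p5 \<noteq> p3" using other_neighbour[OF far[OF p4(1,2)] p4(3)] .
  obtain q5 where Hq4: "H q4 = {q3, q5}" "q5 \<noteq> q3" using other_neighbour[OF far[OF q4(1,2)] q4(3)] .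
  note deg = far[OF x] far[OF p1(1,2)] far[OF p2(1,2)] far[OF p3(1,2)] far[OF p4(1,2)]
    far[OF q1(1,2)] far[OF q2(1,2)] far[OF q3(1,2)] far[OF q4(1,2)]
  note inW = x(1) p1(1) p2(1) p3(1) p4(1) q1(1) q2(1) q3(1) q4(1)
  have r1: "x \<in> reach 1 p1" "x \<in> reach 1 q1"
    using reach_step[OF deg(2) p1(3), of x 0] reach_step[OF deg(6) q1(3), of x 0] by simp_all
  have r2: "x \<in> reach 2 p2" "x \<in> reach 2 q2"
    using reach_step[OF deg(3) p2(3) r1(1)] reach_step[OF deg(7) q2(3) r1(2)] by (simp_all add: eval_nat_numeral)
  have r3: "x \<in> reach 3 p3" "x \<in> reach 3 q3"
    using reach_step[OF deg(4) p3(3) r2(1)] reach_step[OF deg(8) q3(3) r2(2)] by (simp_all add: eval_nat_numeral)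
  have r4: "x \<in> reach 4 p4" "x \<in> reach 4 q4"
    using reach_step[OF deg(5) p4(3) r3(1)] reach_step[OF deg(9) q4(3) r3(2)] by (simp_all add: eval_nat_numeral)
  let ?Z = "{x, p1, p2, p3, p4, q1, q2, q3, q4}"
  have reachZ: "x \<in> reach 4 z" if "z \<in> ?Z" for z
    using that reach_self[of x 4] r1[THEN reach_mono, of 4] r2[THEN reach_mono, of 4] r3[THEN reach_mono, of 4] r4
    by (elim insertE emptyE) (simp_all del: reach.simps)
  have fin: thesis if Z: "Z \<subseteq> ?Z" "x \<in> Z" "colourable x p1 q1 Z" for Z
  proof -
    have "card Z \<le> card ?Z" using Z(1) by (intro card_mono) auto
    also have "\<dots> \<le> 9" using card_length[of "[x, p1, p2, p3, p4, q1, q2, q3, q4]"] by simp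
    finally have "card Z \<le> 9" .
    moreover have "finite Z" using Z(1) by (rule finite_subset) simp
    moreover have "Z \<subseteq> W" using Z(1) inW by auto
    ultimately show thesis using result[OF Z(3) _ Z(2)] reachZ Z(1) by blast
  qed
  have cycle: thesis if "Z \<subseteq> ?Z" "x \<in> Z" "\<forall>v\<in>Z. H v \<subseteq> Z" for Z
  proof (rule fin[OF that(1,2)], rule colourable_closed)
    show "Z \<subseteq> W" using that(1) inW by auto
    show "card (H v) = 2" if "v \<in> Z" for v
      using \<open>Z \<subseteq> ?Z\<close>[THEN subsetD, OF that] by (elim insertE emptyE) (simp_all only: deg)
  qed (use that Hx in auto)
  show thesis
  proof (rule ccontr)
    \<comment> \<open>By \<open>cycle\<close>, no subset of \<open>?Z\<close> containing x is closed
      under H. Any coincidence between the two arms would produce such a subset, so the nine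
      vertices are distinct and the arms continue outside.\<close>
    assume neg: "\<not> thesis"
    have irr: "x \<noteq> p1" "x \<noteq> q1" "p1 \<noteq> p2" "q1 \<noteq> q2" "p2 \<noteq> p3" "q2 \<noteq> q3" "p3 \<noteq> p4" "q3 \<noteq> q4" "p4 \<noteq> p5" "q4 \<noteq> q5"
      using H_irrefl[of x] H_irrefl[of p1] H_irrefl[of q1] H_irrefl[of p2] H_irrefl[of q2]
        H_irrefl[of p3] H_irrefl[of q3] H_irrefl[of p4] H_irrefl[of q4] Hx Hp1 Hq1 Hp2 Hq2 Hp3 Hq3 Hp4 Hq4 by auto
    have n1: "p2 \<noteq> q1"
    proof
      assume e: "p2 = q1"
      then have "p1 \<in> H q1" using p2(3) by simp
      then have "q2 = p1" using Hq1 irr by auto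
      then show False using neg cycle[of "{x, p1, q1}"] Hx Hp1 Hq1 e by auto
    qed
    have n1': "q2 \<noteq> p1" using q2(3) Hp1 n1 irr by auto
    have n2: "p2 \<noteq> q2"
    proof
      assume e: "p2 = q2"
      then have "q1 \<in> H p2" using q2(3) by simp
      then have "p3 = q1" using Hp2 Hx by auto
      then show False using neg cycle[of "{x, p1, q1, p2}"] Hx Hp1 Hq1 Hp2 e by auto
    qed
    have m2: "p2 \<noteq> x" "q2 \<noteq> x" using Hp1 Hq1 by auto
    have n3: "p3 \<noteq> q2"
    proof
      assume e: "p3 = q2"
      then have "p2 \<in> H q2" using p3(3) by simp
      then have "q3 = p2" using Hq2 n1 by auto
      then show False using neg cycle[of "{x, p1, q1, p2, q2}"] Hx Hp1 Hq1 Hp2 Hq2 e by auto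
    qed
    have m3: "p3 \<noteq> x" "p3 \<noteq> q1" "p3 \<noteq> p1" using p3(3) Hx Hp1 Hq1 Hp2(2) n1 n2 m2 irr by auto
    have m3': "q3 \<noteq> x" "q3 \<noteq> p1" "q3 \<noteq> q1" using q3(3) Hx Hp1 Hq1 Hq2(2) n1' n2 m2 irr by auto
    have "q3 \<noteq> p2" using q3(3) Hp2 n1' n3 by auto
    have n4: "p3 \<noteq> q3"
    proof
      assume e: "p3 = q3"
      then have "q2 \<in> H p3" using q3(3) by simp
      then have "p4 = q2" using Hp3 n2 by auto
      then show False using neg cycle[of "{x, p1, q1, p2, q2, p3}"] Hx Hp1 Hq1 Hp2 Hq2 Hp3 e by auto
    qed
    have n5: "p4 \<noteq> q3"
    proof
      assume e: "p4 = q3"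
      then have "p3 \<in> H q3" using p4(3) by simp
      then have "q4 = p3" using Hq3 n3 by auto
      then show False using neg cycle[of "{x, p1, q1, p2, q2, p3, q3}"] Hx Hp1 Hq1 Hp2 Hq2 Hp3 Hq3 e by auto
    qed
    have m4: "p4 \<noteq> x" "p4 \<noteq> p1" "p4 \<noteq> q1" "p4 \<noteq> q2" "p4 \<noteq> p2"
      using p4(3) Hx Hp1 Hq1 Hq2 Hp3(2) m3 n3 n4 irr by auto
    have m4': "q4 \<noteq> x" "q4 \<noteq> q1" "q4 \<noteq> p1" "q4 \<noteq> p2" "q4 \<noteq> q2"
      using q4(3) Hx Hp1 Hq1 Hp2 Hq3(2) m3' \<open>q3 \<noteq> p2\<close> n4 irr by auto
    have "q4 \<noteq> p3" using q4(3) Hp3 \<open>q3 \<noteq> p2\<close> n5 by auto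
    have n6: "p4 \<noteq> q4"
    proof
      assume e: "p4 = q4"
      then have "q3 \<in> H p4" using q4(3) by simp
      then have "p5 = q3" using Hp4 n4 by auto
      then show False
        using neg cycle[of "{x, p1, q1, p2, q2, p3, q3, p4}"] Hx Hp1 Hq1 Hp2 Hq2 Hp3 Hq3 Hp4 e by auto
    qed
    have n7: "p5 \<noteq> q4"
    proof
      assume e: "p5 = q4"
      have "p4 \<in> H p5" using H_sym[OF p4(1)] Hp4 by auto
      then have "q5 = p4" using Hq4 n5 e by auto
      then show False
        using neg cycle[of "{x, p1, q1, p2, q2, p3, q3, p4, q4}"] Hx Hp1 Hq1 Hp2 Hq2 Hp3 Hq3 Hp4 Hq4 e by auto
    qed
    have p5: "p4 \<in> H p5" and q5: "q4 \<in> H q5"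
      using H_sym[OF p4(1), of p5] H_sym[OF q4(1), of q5] Hp4 Hq4 by auto
    have out_p: "p5 \<notin> ?Z"
    proof -
      have "p5 \<noteq> x" "p5 \<noteq> p1" "p5 \<noteq> q1" "p5 \<noteq> p2" "p5 \<noteq> q2" "p5 \<noteq> q3"
        using p5 Hx Hp1 Hq1 Hp2 Hq2 Hq3 m4 n5 n6 irr by auto
      then show ?thesis using Hp4(2) irr n7 by auto
    qed
    have out_q: "q5 \<notin> ?Z"
    proof -
      have *: "q5 \<noteq> s" if "q4 \<notin> H s" for s using that q5 by auto
      have "q5 \<noteq> x" "q5 \<noteq> p1" "q5 \<noteq> q1" "q5 \<noteq> p2" "q5 \<noteq> q2" "q5 \<noteq> p3" "q5 \<noteq> p4"
        using m4' \<open>q4 \<noteq> p3\<close> n6[symmetric] n7[symmetric] irr[symmetric]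
        by (auto intro!: * simp: Hx(1) Hp1(1) Hq1(1) Hp2(1) Hq2(1) Hp3(1) Hp4(1))
      then show ?thesis using Hq4(2) irr(10)[symmetric] by simp
    qed
    have "distinct [x, p1, p2, p3, p4, q1, q2, q3, q4]"
      using irr Hx(2) n1 n1' n2 m2 n3 m3 m3' \<open>q3 \<noteq> p2\<close> n4 n5 m4 m4' \<open>q4 \<noteq> p3\<close> n6 by auto
    moreover have "?Z \<subseteq> W" using inW by simp
    ultimately have "colourable x p1 q1 ?Z"
      using colourable_path[OF _ refl _ Hx(1) Hp1(1) Hp2(1) Hp3(1) Hp4(1) Hq1(1) Hq2(1) Hq3(1) Hq4(1) out_p out_q]
      by blast
    then show False using fin[of ?Z] neg by blast
  qed
qed

section \<open>Counting\<close>

text \<open>Three colours above all values of c on E are fresh for both sets: an edge meeting one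
  set is not contained in the other together with the leaves, so the first recolouring does not
  touch it.\<close>

lemma no_disjoint_colourable:
  assumes "colourable x p q Z" "colourable y p' q' Z'" and Z: "Z \<subseteq> W" "Z' \<subseteq> W" "Z \<inter> Z' = {}"
  shows False
proof -
  obtain c where c: "rainbow_free c" by (rule ex_rainbow_free)
  obtain M where M: "\<forall>f\<in>E. c f < M"
    using finite_nat_set_iff_bounded[of "c ` E"] finite_E by auto
  have fresh: "c f \<notin> {M, Suc M, Suc (Suc M)}" if "f \<in> E" for f using M that by fastforce
  obtain c1 where c1: "rainbow_free c1" "\<forall>f\<in>E. \<not> f \<subseteq> Z \<union> L \<longrightarrow> c1 f = c f"
    "zone c1 x p q Z M (Suc M) (Suc (Suc M))"
    using assms(1)[unfolded colourable_def, rule_format, of c M "Suc M" "Suc (Suc M)"] c fresh by auto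
  have "c1 f \<notin> {M, Suc M, Suc (Suc M)}" if "f \<in> E" "f \<inter> Z' \<noteq> {}" for f
  proof -
    have "\<not> f \<subseteq> Z \<union> L" using that(2) Z W_L_disjoint by blast
    then show ?thesis using c1(2) fresh that(1) by simp
  qed
  then obtain c2 where c2: "rainbow_free c2" "\<forall>f\<in>E. \<not> f \<subseteq> Z' \<union> L \<longrightarrow> c2 f = c1 f"
    "zone c2 y p' q' Z' M (Suc M) (Suc (Suc M))"
    using assms(2)[unfolded colourable_def, rule_format, of c1 M "Suc M" "Suc (Suc M)"] c1(1) by auto
  have "zone c2 x p q Z M (Suc M) (Suc (Suc M))"
  proof (rule zone_cong[OF c1(3)])
    fix f assume f: "f \<in> E" "f \<inter> Z \<noteq> {}"
    have "\<not> f \<subseteq> Z' \<union> L" using f(2) Z W_L_disjoint by blast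
    then show "c2 f = c1 f" using c2(2) f(1) by simp
  qed
  then show False using no_two_zones[OF c2(1) _ c2(3) Z(3)] by blast
qed

text \<open>Fix the set Z of one deep vertex. The corresponding set of any deep y meets Z, and each
  of its vertices reaches y within four steps, so y lies in \<open>reach 4 z\<close> for some z in
  Z. This gives at most 9 * 31 = 279 vertices.\<close>

lemma card_deep: "card (W - near 4) \<le> 279"
proof (cases "W - near 4 = {}")
  case False
  then obtain x where x: "x \<in> W" "x \<notin> near 4" by blast
  obtain p q Z where Z: "colourable x p q Z" "Z \<subseteq> W" "finite Z" "card Z \<le> 9"
    by (rule deep_zone[OF x])
  have "W - near 4 \<subseteq> (\<Union>z\<in>Z. reach 4 z)"
  proof
    fix y assume "y \<in> W - near 4"
    then have y: "y \<in> W" "y \<notin> near 4" by auto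
    obtain p' q' Z' where Z': "colourable y p' q' Z'" "Z' \<subseteq> W" "y \<in> Z'" "finite Z'" "card Z' \<le> 9"
      "Z' \<subseteq> {z. y \<in> reach 4 z}"
      by (rule deep_zone[OF y])
    have "Z \<inter> Z' \<noteq> {}" using no_disjoint_colourable[OF Z(1) Z'(1) Z(2) Z'(2)] by blast
    then show "y \<in> (\<Union>z\<in>Z. reach 4 z)" using Z'(6) by blast
  qed
  then have "card (W - near 4) \<le> card (\<Union>z\<in>Z. reach 4 z)"
    using Z(3) card_reach by (intro card_mono) auto
  also have "\<dots> \<le> (\<Sum>z\<in>Z. card (reach 4 z))" by (rule card_UN_le[OF Z(3)])
  also have "\<dots> \<le> (\<Sum>z\<in>Z. 31)" by (rule sum_mono) (use card_reach[of 4] in simp)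
  also have "\<dots> \<le> 279" using Z(4) by simp
  finally show ?thesis .
next
  case True
  show ?thesis unfolding True by simp
qed

section \<open>Sizes of the distance layers\<close>

lemma near_subset: "near k \<subseteq> W"
  by (induction k) auto

lemma finite_near: "finite (near k)"
  using near_subset finite_W finite_subset by blast

lemma near_Suc_mono: "near k \<subseteq> near (Suc k)"
  by simp

lemma near_0_subset: "near 0 \<subseteq> near k"
  by (induction k) auto

lemma card_layer_1: "card (near (Suc 0) - near 0) \<le> (\<Sum>v\<in>near 0. card (H v))"
proof -
  have "near (Suc 0) - near 0 \<subseteq> (\<Union>v\<in>near 0. H v)"
    using H_sym by (auto simp del: near.simps(1))
  moreover have "finite (\<Union>v\<in>near 0. H v)" using finite_near[of 0] finite_H by blast
  ultimately have "card (near (Suc 0) - near 0) \<le> card (\<Union>v\<in>near 0. H v)" by (intro card_mono)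
  also have "\<dots> \<le> (\<Sum>v\<in>near 0. card (H v))" by (rule card_UN_le[OF finite_near])
  finally show ?thesis .
qed

text \<open>Beyond the first layer every vertex has only one neighbour further out.\<close>

lemma card_layer_Suc:
  "card (near (Suc (Suc k)) - near (Suc k)) \<le> card (near (Suc k) - near k)"
proof -
  let ?D = "near (Suc k) - near k"
  have sub: "near (Suc (Suc k)) - near (Suc k) \<subseteq> (\<Union>u\<in>?D. H u - near (Suc k))"
  proof
    fix v assume v: "v \<in> near (Suc (Suc k)) - near (Suc k)"
    then obtain u where u: "v \<in> W" "u \<in> H v" "u \<in> near (Suc k)" by (auto simp del: near.simps(1)) 
    have "u \<notin> near k" using v u by auto
    then show "v \<in> (\<Union>u\<in>?D. H u - near (Suc k))" using H_sym[OF u(1,2)] u(3) v by blast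
  qed
  have one: "card (H u - near (Suc k)) \<le> 1" if u: "u \<in> ?D" for u
  proof -
    have "u \<notin> near 0" "u \<in> W" using u near_0_subset near_subset by blast+
    then have two: "card (H u) = 2" by simp
    obtain w where w: "w \<in> H u" "w \<in> near k" using u by auto
    have "card (H u - near (Suc k)) \<le> card (H u - {w})"
      using finite_H w(2) near_Suc_mono by (intro card_mono) blast+
    then show ?thesis using two w(1) by simp
  qed
  have "card (near (Suc (Suc k)) - near (Suc k)) \<le> card (\<Union>u\<in>?D. H u - near (Suc k))"
    using sub finite_near[of "Suc k"] finite_H by (intro card_mono) blast+
  also have "\<dots> \<le> (\<Sum>u\<in>?D. card (H u - near (Suc k)))"
    using finite_near[of "Suc k"] by (intro card_UN_le) blast
  also have "\<dots> \<le> (\<Sum>u\<in>?D. 1)" by (rule sum_mono) (rule one)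
  finally show ?thesis by simp
qed

lemma card_near: "card (near k) \<le> card (near 0) + k * (\<Sum>v\<in>near 0. card (H v))"
proof -
  let ?s = "\<Sum>v\<in>near 0. card (H v)"
  have layer: "card (near (Suc k) - near k) \<le> ?s" for k
  proof (induction k)
    case 0
    show ?case by (rule card_layer_1)
  next
    case (Suc k)
    then show ?case using card_layer_Suc[of k] by linarith
  qed
  show ?thesis
  proof (induction k)
    case (Suc k)
    have "near (Suc k) = near k \<union> (near (Suc k) - near k)" using near_Suc_mono[of k] by blast
    then have "card (near (Suc k)) \<le> card (near k) + card (near (Suc k) - near k)"
      by (metis card_Un_le)
    then show ?case using Suc layer[of k] by (simp del: near.simps)
  qed simp
qed

section \<open>Degree sums and the edge bound\<close>

definition low :: "'a set" where
  "low = {v \<in> W. card (H v) \<le> 1}"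

text \<open>A vertex left with at most one non-leaf neighbour is isolated, or has total degree 2
  with a leaf that is therefore weak. There is at most one isolated vertex, and the at most two weak
  leaves have one neighbour each.\<close>

lemma card_low: "card low \<le> 3"
proof -
  let ?I = "{v \<in> V. N v = {}}"
  have fin: "finite weak_leaves" using finite_L by (rule finite_subset[rotated]) (auto simp: weak_leaves_def)
  have "low \<subseteq> ?I \<union> (\<Union>l\<in>weak_leaves. N l)"
  proof
    fix v assume "v \<in> low"
    then have v: "v \<in> V" "v \<notin> L" "card (H v) \<le> 1" by (auto simp: low_def W_def)
    have "card (N v) \<le> card (H v) + card (N v \<inter> L)"
      by (subst N_split) (rule card_Un_le)
    then have le: "card (N v) \<le> 2" and le': "card (N v) \<le> 1 + card (N v \<inter> L)"
      using v(3) card_leaf_nb[of v] by linarith+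
    show "v \<in> ?I \<union> (\<Union>l\<in>weak_leaves. N l)"
    proof (cases "N v = {}")
      case True
      then show ?thesis using v(1) by blast
    next
      case False
      then have "card (N v) \<noteq> 0" "card (N v) \<noteq> 1" using v(1,2) finite_N by (auto simp: L_def)
      then have "card (N v \<inter> L) \<noteq> 0" using le' by linarith
      then have "N v \<inter> L \<noteq> {}" by auto
      then obtain l where l: "l \<in> L" "{l, v} \<in> E" by (auto simp: insert_commute)
      then have "l \<in> weak_leaves" using le by (auto simp: weak_leaves_def)
      then show ?thesis using l(2) by auto
    qed
  qed
  then have "card low \<le> card (?I \<union> (\<Union>l\<in>weak_leaves. N l))"
    using finite_V fin finite_N by (intro card_mono) auto
  also have "\<dots> \<le> card ?I + card (\<Union>l\<in>weak_leaves. N l)" by (rule card_Un_le)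
  also have "card (\<Union>l\<in>weak_leaves. N l) \<le> (\<Sum>l\<in>weak_leaves. card (N l))" by (rule card_UN_le[OF fin])
  also have "\<dots> = (\<Sum>l\<in>weak_leaves. 1)" by (rule sum.cong) (auto simp: weak_leaves_def L_def)
  finally show ?thesis using isolated_le_one card_weak_leaves by simp
qed

lemma sum_degrees: "(\<Sum>v\<in>V. card (N v)) = 2 * card E"
proof -
  have "card (N v) = card {e \<in> E. v \<in> e}" for v
    using vertex_degree_nb[of G v] edge_card by (simp add: vertex_degree_def)
  moreover have "(\<Sum>v\<in>V. card {e \<in> E. v \<in> e}) = 2 * card E"
  proof (rule sum_multicount[OF finite_V finite_E], rule ballI)
    fix e assume e: "e \<in> E"
    have "{v \<in> V. v \<in> e} = e" using edge_subset[OF e] by blast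
    then show "card {v \<in> V. v \<in> e} = 2" using edge_card[OF e] by simp
  qed
  ultimately show ?thesis by simp
qed

text \<open>In S the truncated subtraction gives 0 for degrees 0 and 1; \<open>ind\<close> corrects
  this at no more than three vertices. As all but at most two leaves hang on W, 2|E| \<ge> 2|V| + S
  - 8. With |W| \<le> 13 S + 294 and |V| \<le> 2|W| + 2 the error is 798 = 208 + 588 + 2.\<close>

lemma edge_bound: "53 * card V \<le> 52 * card E + 798"
proof -
  define S where "S = (\<Sum>v\<in>W. card (H v) - 2)"
  define ind where "ind v = (if card (H v) \<le> 1 then 1 else 0 :: nat)" for v
  have "(\<Sum>v\<in>W. ind v) = card low"
    using finite_W by (simp add: ind_def low_def sum.If_cases Int_def)
  then have ind3: "(\<Sum>v\<in>W. ind v) \<le> 3" using card_low by simp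
  have sub: "(\<Sum>v\<in>near 0. g v) \<le> (\<Sum>v\<in>W. g v)" for g :: "'a \<Rightarrow> nat"
    by (rule sum_mono2[OF finite_W near_subset]) simp
  have "card (near 0) = (\<Sum>v\<in>near 0. 1)" by (simp del: near.simps)
  also have "\<dots> \<le> (\<Sum>v\<in>near 0. (card (H v) - 2) + ind v)"
    by (rule sum_mono) (auto simp: ind_def)
  also have "\<dots> \<le> S + 3"
    using sub[of "\<lambda>v. (card (H v) - 2) + ind v"] ind3 by (simp add: sum.distrib S_def del: near.simps)
  finally have near0: "card (near 0) \<le> S + 3" .
  \<comment> \<open>Degrees d \<ge> 3 satisfy d \<le> 3 (d - 2), and \<open>ind\<close> pays for
    degree 1. With four layers this yields the factor 1 + 4 * 3 = 13.\<close>
  have "(\<Sum>v\<in>near 0. card (H v)) \<le> (\<Sum>v\<in>near 0. 3 * (card (H v) - 2) + ind v)"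
    by (rule sum_mono) (auto simp: ind_def)
  also have "\<dots> \<le> 3 * S + 3"
    using sub[of "\<lambda>v. 3 * (card (H v) - 2) + ind v"] ind3
    by (simp add: sum.distrib S_def sum_distrib_left[symmetric] del: near.simps)
  finally have "card (near 4) \<le> 13 * S + 15" using card_near[of 4] near0 by linarith
  moreover have "card W \<le> card (near 4) + card (W - near 4)"
    using card_Un_le[of "near 4" "W - near 4"] near_subset[of 4] by (simp add: Un_absorb1 del: near.simps)
  ultimately have cardW: "card W \<le> 13 * S + 294" using card_deep by linarith
  have "(\<Sum>v\<in>W. 2 + (card (H v) - 2)) \<le> (\<Sum>v\<in>W. card (H v) + 2 * ind v)"
    by (rule sum_mono) (auto simp: ind_def)
  moreover have "(\<Sum>v\<in>W. 2 + (card (H v) - 2)) = 2 * card W + S"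
    unfolding sum.distrib S_def by simp
  moreover have "(\<Sum>v\<in>W. card (H v) + 2 * ind v) = (\<Sum>v\<in>W. card (H v)) + 2 * (\<Sum>v\<in>W. ind v)"
    by (simp add: sum.distrib sum_distrib_left)
  ultimately have sumH: "2 * card W + S \<le> (\<Sum>v\<in>W. card (H v)) + 6" using ind3 by linarith
  let ?l = "\<Sum>v\<in>W. card (N v \<inter> L)"
  have lW: "?l \<le> card W"
    using sum_mono[of W "\<lambda>v. card (N v \<inter> L)" "\<lambda>_. 1"] card_leaf_nb by simp
  have "L - weak_leaves \<subseteq> (\<Union>v\<in>W. N v \<inter> L)"
  proof
    fix l assume l: "l \<in> L - weak_leaves"
    then have "card (N l) = 1" by (simp add: L_def)
    then obtain u where "N l = {u}" by (rule card_1_singletonE)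
    then have u: "{l, u} \<in> E" by auto
    then have "\<not> card (N u) \<le> 2" using l by (auto simp: weak_leaves_def)
    then have "u \<in> W" using edge_vertices[OF u] by (auto simp: W_def L_def)
    then show "l \<in> (\<Union>v\<in>W. N v \<inter> L)" using u l by (auto simp: insert_commute)
  qed
  then have "card (L - weak_leaves) \<le> card (\<Union>v\<in>W. N v \<inter> L)"
    using finite_W finite_N by (intro card_mono) auto
  also have "\<dots> \<le> ?l" by (rule card_UN_le[OF finite_W])
  moreover have "card L - card weak_leaves \<le> card (L - weak_leaves)"
    by (rule diff_card_le_card_Diff) (auto simp: weak_leaves_def intro: finite_subset[OF _ finite_L])
  ultimately have Ll: "card L \<le> ?l + 2" using card_weak_leaves by linarith
  have VWL: "V = W \<union> L" "W \<inter> L = {}" using L_subset by (auto simp: W_def)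
  have split: "card (N v) = card (H v) + card (N v \<inter> L)" for v
  proof -
    have "card (H v \<union> (N v \<inter> L)) = card (H v) + card (N v \<inter> L)"
      using finite_H finite_N by (intro card_Un_disjoint) (auto simp: H_def)
    then show ?thesis using N_split[of v] by simp
  qed
  have "2 * card E = (\<Sum>v\<in>W. card (N v)) + (\<Sum>v\<in>L. card (N v))"
    unfolding sum_degrees[symmetric] VWL(1) by (rule sum.union_disjoint[OF finite_W finite_L VWL(2)])
  also have "(\<Sum>v\<in>L. card (N v)) = card L" by (simp add: L_def)
  also have "(\<Sum>v\<in>W. card (N v)) = (\<Sum>v\<in>W. card (H v)) + ?l" by (simp add: split sum.distrib)
  finally have "2 * card E = (\<Sum>v\<in>W. card (H v)) + ?l + card L" .
  moreover have "card V = card W + card L"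
    unfolding VWL(1) by (rule card_Un_disjoint[OF finite_W finite_L VWL(2)])
  ultimately show ?thesis using sumH cardW lW Ll by linarith
qed

end

section \<open>Existence of saturated graphs and the final estimate\<close>

text \<open>Makes the infimum in \<open>sat_star\<close> an attained one. An inclusion-maximal edge
  set with a rainbow-free proper colouring is saturated, and the empty edge set is a candidate
  because a branching tree has edges.\<close>

lemma ex_saturated_graph:
  assumes T: "branching_tree (vertices T) (edges T)"
  shows "\<exists>G :: nat graph. finite_simple_graph G \<and> card (vertices G) = n \<and> properly_rainbow_saturated G T"
proof -
  define g where "g F = \<lparr>vertices = {..<n}, edges = F\<rparr>" for F :: "nat set set"
  define X where "X = {F. F \<subseteq> {e. e \<subseteq> {..<n} \<and> card e = 2} \<and>
    (\<exists>c. proper_colouring (g F) c \<and> \<not> has_rainbow_copy (g F) c T)}"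
  have "finite X"
    by (rule finite_subset[of _ "Pow (Pow {..<n})"]) (auto simp: X_def)
  moreover have "{} \<in> X"
  proof -
    have "\<not> has_rainbow_copy (g {}) c T" for c
    proof
      assume "has_rainbow_copy (g {}) c T"
      then obtain K where K: "subgraph K (g {})" "isomorphic K T" unfolding has_rainbow_copy_def by blast
      then have "branching_tree (vertices K) {}"
        using branching_tree_isomorphic[OF _ K(2) T] by (simp add: subgraph_def g_def)
      then show False by (rule branching_tree_branches) (simp add: nb_def)
    qed
    then show ?thesis by (simp add: X_def proper_colouring_def g_def)
  qed
  ultimately obtain F where F: "F \<in> X" "\<And>F'. F' \<in> X \<Longrightarrow> F \<subseteq> F' \<Longrightarrow> F = F'"
    using finite_has_maximal[of X] by blast
  have add: "add_edge (g F) e = g (insert e F)" for e by (simp add: add_edge_def g_def)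
  have "properly_rainbow_saturated (g F) T"
    unfolding properly_rainbow_saturated_def add
  proof (intro conjI ballI allI impI)
    show "\<exists>c. proper_colouring (g F) c \<and> \<not> has_rainbow_copy (g F) c T" using F(1) by (simp add: X_def)
    fix u v c
    assume uv: "u \<in> vertices (g F)" "v \<in> vertices (g F)" "u \<noteq> v \<and> {u, v} \<notin> edges (g F)"
      and c: "proper_colouring (g (insert {u, v} F)) c"
    show "has_rainbow_copy (g (insert {u, v} F)) c T"
    proof (rule ccontr)
      assume "\<not> has_rainbow_copy (g (insert {u, v} F)) c T"
      then have "insert {u, v} F \<in> X" using F(1) uv c by (auto simp: X_def g_def)
      then show False using F(2)[of "insert {u, v} F"] uv by (auto simp: g_def)
    qed
  qed
  moreover have "finite_simple_graph (g F)" using F(1) by (auto simp: X_def g_def finite_simple_graph_def)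
  moreover have "card (vertices (g F)) = n" by (simp add: g_def)
  ultimately show ?thesis by blast
qed

theorem theorem1p5:
  fixes T :: "'a graph" and w :: "'a list" and t r :: nat
  assumes "is_tree T"
    and "graph_diameter T \<ge> 4"
    and "\<forall>v\<in>vertices T. vertex_degree T v = 2 \<longrightarrow> (\<forall>u. {u, v} \<in> edges T \<longrightarrow> \<not> leaf T u)"
    and "longest_bare_path T w"
    and "length w = t + 1"
    and "r = max t 2"
  shows "\<exists>f :: nat \<Rightarrow> real. f \<in> O(\<lambda>_. 1) \<and>
    (\<forall>n. real (sat_star n T) \<ge> (1 + 1 / (12 * real r + 52)) * real n + f n)"
proof (intro exI conjI allI)
  \<comment> \<open>The error function is the constant left by \<open>edge_bound\<close> after
    division by 52.\<close>
  show "(\<lambda>_. - 798 / 52) \<in> O(\<lambda>_. 1 :: real)" by simp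
  fix n
  note T = branching_tree_of_tree[OF assms(1-3)]
  let ?A = "{card (edges G) | G :: nat graph.
     finite_simple_graph G \<and> card (vertices G) = n \<and> properly_rainbow_saturated G T}"
  have "?A \<noteq> {}" using ex_saturated_graph[OF T] by blast
  then have "sat_star n T \<in> ?A" unfolding sat_star_def by (rule Inf_nat_def1)
  then obtain G :: "nat graph" where G: "sat_star n T = card (edges G)" "finite_simple_graph G"
    "card (vertices G) = n" "properly_rainbow_saturated G T" by blast
  interpret rainbow_saturated G T
    using G T by unfold_locales
  have "53 * real n \<le> 52 * real (sat_star n T) + 798"
    using edge_bound unfolding G(1,3) by linarith
  \<comment> \<open>The factor 1 + 1/52 from \<open>edge_bound\<close> is at least the claimed
    one.\<close>
  moreover have "1 / (12 * real r + 52) \<le> 1 / (52 :: real)" by (simp add: field_simps)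
  then have "(1 + 1 / (12 * real r + 52)) * real n \<le> (1 + 1 / 52) * real n"
    by (intro mult_right_mono) auto
  moreover have "(1 + 1 / 52) * real n = 53 * real n / 52" by (simp add: field_simps)
  ultimately show "real (sat_star n T) \<ge> (1 + 1 / (12 * real r + 52)) * real n + - 798 / 52"
    by linarith
qed

end
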